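(* Let $p_n$ denote the $n$th prime number. Assume that for some positive constant $\theta<1$ and some positive integer $N_\theta$ the inequality $$p_{n+1}-p_n\le p_n^{\theta}$$ holds for every $n\ge N_\theta$. For $1/2<t<1$, let $M$ be a positive integer satisfying $$M\ge \max\left\{4^{\frac{1}{1-t}}\left(\frac{20\cdot 2^{6t-t^2}(2t-1)}{3(1-t)^2(1-2^{1-2t})}\right)^{\frac{2}{t(1-t)}},\ \left(50\left(\frac65\right)^{t(2-t)}\right)^{\frac{2}{1-t}}\right\},$$ and let $N_0$ be a positive integer satisfying $$\begin{aligned}N_0\ge \max\biggl\{&N_\theta,\ 85536M^5,\ 3\times 10^{18},\ 2e^{\frac{16}{(1-t)^4}},\ \frac{1}{1-2^{-\frac{1}{2t-1}}},\\ &M^{\frac{1}{(1-t)^2}},\ \left(\frac{40}{7}(1-t)^2\right)^{\frac2t}\left(\frac{2^{1+2t}}{2t-1}\right)^{\frac{2-t}{t}}M^{\frac{1+t}{t}},\ e^{\frac{1}{(2t-1)(1-t)}}\biggr\}.\end{aligned}$$ Then, for any positive integer $n_0\ge N_0$, squares of sidelength $p_n^{-t}$ for $n\ge n_0$ can be packed perfectly into a square of area $\sum_{n=n_0}^{\infty}p_n^{-2t}$.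
   Context: A finite or countably infinite family of squares in the plane is packed into a region $\Omega$ if they are all contained in $\Omega$ and have pairwise disjoint interiors; it is packed perfectly into $\Omega$ if moreover the family covers $\Omega$ up to a null set. "Squares of sidelength $s_n$ for $n\ge n_0$ can be packed perfectly into $\Omega$" means that one can place, for each integer $n\ge n_0$, one square of sidelength $s_n$ so that the resulting family is packed perfectly into $\Omega$. *)

theory Defs
  imports "HOL-Analysis.Analysis" "HOL-Computational_Algebra.Primes" "HOL-Library.Infinite_Set"
begin

text \<open>Primes are numbered from 1, so that \<open>nth_prime 1 = 2\<close>, whereas \<^const>\<open>enumerate\<close>
  counts from 0. The value at 0 is irrelevant.\<close>

definition nth_prime :: "nat \<Rightarrow> nat" where
  "nth_prime n = enumerate {p. prime p} (n - 1)"

text \<open>Squares are closed and may be rotated: \<open>a\<close> is a vertex, and the unit vectors \<open>u\<close>, \<open>v\<close>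
  give the directions of the two sides at \<open>a\<close>.\<close>

definition is_square :: "real \<Rightarrow> (real ^ 2) set \<Rightarrow> bool" where
  "is_square s Q \<longleftrightarrow> s > 0 \<and>
     (\<exists>a u v. norm u = 1 \<and> norm v = 1 \<and> u \<bullet> v = 0 \<and>
        Q = {a + x *\<^sub>R u + y *\<^sub>R v | x y. x \<in> {0..s} \<and> y \<in> {0..s}})"

definition packed :: "'i set \<Rightarrow> ('i \<Rightarrow> (real ^ 2) set) \<Rightarrow> (real ^ 2) set \<Rightarrow> bool" where
  "packed I Q \<Omega> \<longleftrightarrow>
     (\<forall>i\<in>I. Q i \<subseteq> \<Omega>) \<and> pairwise (\<lambda>i j. interior (Q i) \<inter> interior (Q j) = {}) I"

definition packed_perfectly :: "'i set \<Rightarrow> ('i \<Rightarrow> (real ^ 2) set) \<Rightarrow> (real ^ 2) set \<Rightarrow> bool" where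
  "packed_perfectly I Q \<Omega> \<longleftrightarrow> packed I Q \<Omega> \<and> negligible (\<Omega> - (\<Union>i\<in>I. Q i))"

definition squares_pack_perfectly :: "'i set \<Rightarrow> ('i \<Rightarrow> real) \<Rightarrow> (real ^ 2) set \<Rightarrow> bool" where
  "squares_pack_perfectly I s \<Omega> \<longleftrightarrow>
     (\<exists>Q. (\<forall>i\<in>I. is_square (s i) (Q i)) \<and> packed_perfectly I Q \<Omega>)"

end

theory Submission
  imports Defs
begin

text \<open>
  The squares are placed greedily in rows. At every stage the part of the big square that is still
  free is a union of finitely many rectangles (bricks); take the one whose shorter side \<open>w\<close> is
  largest, and put a row of squares of the next sizes along that side. What remains of the brick is
  again made of bricks: thin slivers above the squares of the row, a piece at its end, and the rest
  of the brick. As area is conserved, the packing is perfect provided that the process never gets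
  stuck, that is, provided that \<open>w\<close> stays large compared with the current sidelength.

  The width \<open>w\<close> is controlled by the sum of \<open>w\<^sup>\<delta> h\<close> over the \<open>w \<times> h\<close> bricks with
  \<open>w \<le> h\<close>, where \<open>\<delta> = 1 - t\<close>: this sum dominates the free area divided by the largest
  \<open>w\<^sup>1\<^sup>-\<^sup>\<delta>\<close>. Rest pieces of bricks do not increase the sum, end pieces are rare because
  rows are long, and the widths of the slivers are controlled on average, since the sidelengths
  telescope. Chebyshev's bound \<open>p\<^sub>n = O(n log n)\<close> bounds the free area from below; the
  logarithms are absorbed by powers of \<open>n\<close>.
\<close>

section \<open>Bricks and rows\<close>

type_synonym brick = "real \<times> real \<times> real \<times> real"

text \<open>The brick \<open>(x, y, a, b)\<close> stands for the rectangle \<open>[x, x + a] \<times> [y, y + b]\<close>.\<close>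

fun sep :: "brick \<Rightarrow> brick \<Rightarrow> bool" where
  "sep (x, y, a, b) (x', y', a', b') \<longleftrightarrow>
     x + a \<le> x' \<or> x' + a' \<le> x \<or> y + b \<le> y' \<or> y' + b' \<le> y"

text \<open>It also demands nonnegative sides of the inner brick, so \<open>subbrick c c\<close>
  says that \<open>c\<close> is a genuine rectangle. Sides of length 0 are allowed, since leftover
  pieces may be degenerate.\<close>

fun subbrick :: "brick \<Rightarrow> brick \<Rightarrow> bool" where
  "subbrick (x, y, a, b) (x', y', a', b') \<longleftrightarrow>
     0 \<le> a \<and> 0 \<le> b \<and> x' \<le> x \<and> x + a \<le> x' + a' \<and> y' \<le> y \<and> y + b \<le> y' + b'"

fun area :: "brick \<Rightarrow> real" where
  "area (x, y, a, b) = a * b"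

text \<open>This is \<open>w\<^sup>\<delta> h\<close>, where \<open>w \<le> h\<close> are the two sidelengths.\<close>

fun girth :: "real \<Rightarrow> brick \<Rightarrow> real" where
  "girth \<delta> (x, y, a, b) = max (a powr \<delta> * b) (a * b powr \<delta>)"

text \<open>The reflection in the diagonal, which exchanges the roles of the two sides of a
  brick.\<close>

fun flip :: "brick \<Rightarrow> brick" where
  "flip (x, y, a, b) = (y, x, b, a)"

lemma sep_sym: "sep c d \<longleftrightarrow> sep d c"
  by (cases c; cases d) auto

lemma sep_subbrick: "subbrick c r \<Longrightarrow> sep r d \<Longrightarrow> sep c d"
  by (cases c; cases d; cases r) auto

lemma subbrick_trans: "subbrick c d \<Longrightarrow> subbrick d e \<Longrightarrow> subbrick c e"
  by (cases c; cases d; cases e) auto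

lemma sep_flip [simp]: "sep (flip c) (flip d) \<longleftrightarrow> sep c d"
  by (cases c; cases d) auto

lemma subbrick_flip: "subbrick c (flip d) \<Longrightarrow> subbrick (flip c) d"
  by (cases c; cases d) auto

lemma area_flip [simp]: "area (flip c) = area c"
  by (cases c) auto

lemma girth_flip [simp]: "girth \<delta> (flip c) = girth \<delta> c"
  by (cases c) (simp add: max.commute mult.commute)

lemma area_nonneg: "subbrick c d \<Longrightarrow> 0 \<le> area c"
  by (cases c; cases d) auto

lemma girth_nonneg: "subbrick c d \<Longrightarrow> 0 \<le> girth \<delta> c"
  by (cases c; cases d) (auto simp: le_max_iff_disj)

lemma girth_mono:
  assumes "0 \<le> \<delta>" "0 \<le> a" "a \<le> a'" "0 \<le> b" "b \<le> b'"
  shows "girth \<delta> (x, y, a, b) \<le> girth \<delta> (x', y', a', b')"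
  unfolding girth.simps using assms by (intro max.mono mult_mono powr_mono2) auto

lemma girth_square: "0 < a \<Longrightarrow> girth \<delta> (x, y, a, a) = a powr (1 + \<delta>)"
  by (simp add: powr_add mult.commute)

text \<open>For sides \<open>w \<le> h\<close> one has
  \<open>w * h = w^(1 - \<delta>) * (w^\<delta> * h)\<close>. This is what turns a bound on the
  total girth into a lower bound on the width of some brick.\<close>

lemma area_le_girth:
  assumes "0 \<le> a" "0 \<le> b" "\<delta> \<le> 1"
  shows "area (x, y, a, b) \<le> min a b powr (1 - \<delta>) * girth \<delta> (x, y, a, b)"
proof -
  have *: "a powr (1 - \<delta>) * (a powr \<delta> * b) = a * b" if "a \<ge> 0" for a b :: real
    using that by (simp add: powr_add[symmetric] mult.assoc[symmetric])
  show ?thesis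
  proof (cases "a \<le> b")
    case True
    have "a * b = a powr (1 - \<delta>) * (a powr \<delta> * b)" using *[OF assms(1), of b] by (simp only:)
    also have "\<dots> \<le> a powr (1 - \<delta>) * girth \<delta> (x, y, a, b)" by (intro mult_left_mono) auto
    finally show ?thesis using True by simp
  next
    case False
    have "a * b = b powr (1 - \<delta>) * (b powr \<delta> * a)" using *[OF assms(2), of a] by (simp only: mult.commute)
    also have "\<dots> \<le> b powr (1 - \<delta>) * girth \<delta> (x, y, a, b)"
      by (intro mult_left_mono) (auto simp: mult.commute)
    finally show ?thesis using False by simp
  qed
qed

text \<open>The row stands on the bottom side, inside a strip of height \<open>s 0\<close>. The
  slivers \<open>v i\<close> fill the strip above the squares, \<open>e\<close> is the end of the
  strip and \<open>r\<close> the brick above it. For the girths: \<open>r\<close> lies in the whole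
  brick, \<open>e\<close> fits into a square of side \<open>s 0\<close>, and each sliver fits into a
  rectangle with sides \<open>s 0\<close> and \<open>s 0 - s m\<close>.\<close>

lemma row:
  fixes s :: "nat \<Rightarrow> real"
  assumes "antimono s" and pos: "\<And>i. 0 < s i" and "0 \<le> \<delta>" and "\<delta> \<le> 1"
    and le: "(\<Sum>i<m. s i) \<le> w" and gap: "w - (\<Sum>i<m. s i) \<le> s 0" and "s 0 \<le> h"
  shows "\<exists>qs bs. length qs = m \<and> (\<forall>i<m. \<exists>x y. qs ! i = (x, y, s i, s i)) \<and>
    sorted_wrt sep (qs @ bs) \<and> (\<forall>c\<in>set (qs @ bs). subbrick c (x, y, w, h)) \<and>
    sum_list (map area bs) = w * h - (\<Sum>i<m. (s i)\<^sup>2) \<and>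
    sum_list (map (girth \<delta>) bs) \<le> girth \<delta> (x, y, w, h) + s 0 powr (1 + \<delta>) +
      real m * (s 0 * (s 0 - s m) powr \<delta>)"
proof -
  define S where "S i = (\<Sum>j<i. s j)" for i
  have S_le: "S i + s i \<le> S j" if "i < j" for i j
  proof -
    have "S (Suc i) \<le> S j" unfolding S_def
      using that pos by (intro sum_mono2) (auto intro: less_imp_le)
    then show ?thesis by (simp add: S_def)
  qed
  have S0: "0 \<le> S i" for i unfolding S_def using pos by (intro sum_nonneg) (auto intro: less_imp_le)
  have Sw: "S i + s i \<le> w" if "i < m" for i using S_le[OF that] le by (simp add: S_def)
  have Smw: "S m \<le> w" "w \<le> S m + s 0" using le gap by (auto simp: S_def)
  have mono: "s i \<le> s 0" "i \<le> m \<Longrightarrow> s m \<le> s i" for i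
    using \<open>antimono s\<close> by (auto simp: antimono_def)
  define q where "q i = (x + S i, y, s i, s i)" for i
  define v where "v i = (x + S i, y + s i, s i, s 0 - s i)" for i
  define e where "e = (x + S m, y, w - S m, s 0)"
  define r where "r = (x, y + s 0, w, h - s 0)"
  define qs bs where "qs = map q [0..<m]" and "bs = map v [0..<m] @ [e, r]"
  have "0 \<le> w" using le S0[of m] by (simp add: S_def)
  have "sorted_wrt sep qs" unfolding qs_def using S_le
    by (auto simp: sorted_wrt_map sorted_wrt_iff_nth_less q_def algebra_simps)
  moreover have "sorted_wrt sep (map v [0..<m])" using S_le
    by (auto simp: sorted_wrt_map sorted_wrt_iff_nth_less v_def algebra_simps)
  moreover have "sep (q i) (v j)" for i j
    using S_le[of i j] S_le[of j i] by (cases i j rule: linorder_cases) (auto simp: q_def v_def)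
  moreover have "sep (q i) e" "sep (v i) e" if "i < m" for i
    using S_le[OF that] by (auto simp: q_def v_def e_def)
  moreover have "sep (q i) r" "sep (v i) r" for i
    using mono(1)[of i] by (auto simp: q_def v_def r_def)
  moreover have "sep e r" by (auto simp: e_def r_def)
  ultimately have sorted: "sorted_wrt sep (qs @ bs)"
    by (auto simp: qs_def bs_def sorted_wrt_append)
  have "subbrick (q i) (x, y, w, h)" "subbrick (v i) (x, y, w, h)" if "i < m" for i
    using Sw[OF that] mono(1)[of i] pos[of i] S0[of i] \<open>s 0 \<le> h\<close> by (auto simp: q_def v_def)
  moreover have "subbrick e (x, y, w, h)" "subbrick r (x, y, w, h)"
    using Smw S0[of m] pos[of 0] \<open>0 \<le> w\<close> \<open>s 0 \<le> h\<close> by (auto simp: e_def r_def)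
  ultimately have ins: "\<forall>c\<in>set (qs @ bs). subbrick c (x, y, w, h)"
    by (auto simp: qs_def bs_def)
  have sl: "sum_list (map g [0..<m]) = (\<Sum>i<m. g i)" for g :: "nat \<Rightarrow> real"
    by (simp add: sum_set_upt_conv_sum_list_nat[symmetric] atLeast0LessThan)
  have "sum_list (map area bs) = (\<Sum>i<m. s i * (s 0 - s i)) + (w - S m) * s 0 + w * (h - s 0)"
    by (simp add: bs_def e_def r_def o_def v_def sl)
  also have "(\<Sum>i<m. s i * (s 0 - s i)) = s 0 * S m - (\<Sum>i<m. (s i)\<^sup>2)"
    by (simp add: S_def sum_subtractf[symmetric] sum_distrib_left algebra_simps power2_eq_square)
  finally have ar: "sum_list (map area bs) = w * h - (\<Sum>i<m. (s i)\<^sup>2)"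
    by (simp add: algebra_simps)
  have "girth \<delta> (v i) \<le> s 0 * (s 0 - s m) powr \<delta>" if "i < m" for i
  proof -
    have D: "0 \<le> s 0 - s m" "s 0 - s m \<le> s 0" using mono(1)[of m] pos[of m] by auto
    have 1: "girth \<delta> (v i) \<le> girth \<delta> (0, 0, s 0, s 0 - s m)" unfolding v_def
      using mono[of i] that pos[of i] assms(3) by (intro girth_mono) auto
    \<comment> \<open>As \<open>s 0 - s m\<close> is the shorter side, the second argument of the
      maximum in \<open>girth\<close> dominates.\<close>
    have "s 0 powr \<delta> * (s 0 - s m) \<le> s 0 * (s 0 - s m) powr \<delta>"
    proof (cases "s 0 - s m = 0")
      case False
      have "(s 0 - s m) powr (1 - \<delta>) \<le> s 0 powr (1 - \<delta>)"
        using D \<open>\<delta> \<le> 1\<close> by (intro powr_mono2) auto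
      then have "s 0 powr \<delta> * ((s 0 - s m) powr \<delta> * (s 0 - s m) powr (1 - \<delta>)) \<le>
          s 0 powr \<delta> * ((s 0 - s m) powr \<delta> * s 0 powr (1 - \<delta>))"
        by (intro mult_left_mono) auto
      also have "\<dots> = (s 0 powr \<delta> * s 0 powr (1 - \<delta>)) * (s 0 - s m) powr \<delta>" by simp
      finally show ?thesis using D False pos[of 0] by (simp add: powr_add[symmetric] mult.assoc)
    qed auto
    then have "girth \<delta> (0, 0, s 0, s 0 - s m) \<le> s 0 * (s 0 - s m) powr \<delta>" by simp
    with 1 show ?thesis by linarith
  qed
  then have gv: "(\<Sum>i<m. girth \<delta> (v i)) \<le> real m * (s 0 * (s 0 - s m) powr \<delta>)"
    using sum_bounded_above[of "{..<m}" "\<lambda>i. girth \<delta> (v i)"] by simp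
  have "girth \<delta> e \<le> girth \<delta> (0, 0, s 0, s 0)" unfolding e_def
    using Smw pos[of 0] assms(3) by (intro girth_mono) auto
  also have "\<dots> = s 0 powr (1 + \<delta>)" using pos by (rule girth_square)
  finally have ge: "girth \<delta> e \<le> s 0 powr (1 + \<delta>)" .
  have gr: "girth \<delta> r \<le> girth \<delta> (x, y, w, h)" unfolding r_def
    using pos[of 0] assms \<open>0 \<le> w\<close> by (intro girth_mono) auto
  have "sum_list (map (girth \<delta>) bs) = (\<Sum>i<m. girth \<delta> (v i)) + (girth \<delta> e + girth \<delta> r)"
    by (simp add: bs_def o_def sl)
  with gv ge gr sorted ins ar show ?thesis
    by (intro exI[of _ qs] exI[of _ bs]) (auto simp: qs_def q_def)
qed

section \<open>The greedy packing\<close>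

text \<open>Separation is symmetric and passes to subbricks. So the order of the list is immaterial,
  and a brick may be replaced by separated pieces of it.\<close>

lemma sorted_wrt_sep_replace:
  assumes "sorted_wrt sep (qs @ us @ r # vs)" and "sorted_wrt sep (qs' @ bs)"
    and "\<forall>c\<in>set (qs' @ bs). subbrick c r"
  shows "sorted_wrt sep ((qs @ qs') @ us @ bs @ vs)"
proof -
  have *: "sep c d" "sep d c" if "c \<in> set (qs' @ bs)" "sep r d \<or> sep d r" for c d
    using that assms(3) sep_subbrick sep_sym by blast+
  have "sep r d \<or> sep d r" if "d \<in> set (qs @ us @ vs)" for d
    using that assms(1) by (auto simp: sorted_wrt_append)
  with * have "sep c d" "sep d c" if "c \<in> set (qs' @ bs)" "d \<in> set (qs @ us @ vs)" for c d
    using that by blast+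
  then show ?thesis using assms(1,2) by (auto simp: sorted_wrt_append)
qed

text \<open>The row has to run along the shorter side; \<open>row\<close> covers
  \<open>a \<le> b\<close>, and \<open>flip\<close> reduces the other case to it.\<close>

lemma row_in_brick:
  fixes s :: "nat \<Rightarrow> real"
  assumes "antimono s" and pos: "\<And>i. 0 < s i" and "0 \<le> \<delta>" "\<delta> \<le> 1" and "0 < m"
    and le: "(\<Sum>i<m. s i) \<le> min a b" and gap: "min a b - (\<Sum>i<m. s i) \<le> s 0"
  shows "\<exists>qs bs. length qs = m \<and> (\<forall>i<m. \<exists>x y. qs ! i = (x, y, s i, s i)) \<and>
    sorted_wrt sep (qs @ bs) \<and> (\<forall>c\<in>set (qs @ bs). subbrick c (x, y, a, b)) \<and>
    sum_list (map area bs) = a * b - (\<Sum>i<m. (s i)\<^sup>2) \<and>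
    sum_list (map (girth \<delta>) bs) \<le> girth \<delta> (x, y, a, b) + s 0 powr (1 + \<delta>) +
      real m * (s 0 * (s 0 - s m) powr \<delta>)"
proof -
  have "s 0 \<le> (\<Sum>i<m. s i)"
    using \<open>0 < m\<close> pos by (intro member_le_sum) (auto intro: less_imp_le)
  then have s0: "s 0 \<le> a" "s 0 \<le> b" using le by auto
  show ?thesis
  proof (cases "a \<le> b")
    case True
    then show ?thesis using row[of s \<delta> m a b x y] assms s0 by simp
  next
    case False
    then obtain qs bs where *: "length qs = m" "\<forall>i<m. \<exists>x y. qs ! i = (x, y, s i, s i)"
      "sorted_wrt sep (qs @ bs)" "\<forall>c\<in>set (qs @ bs). subbrick c (y, x, b, a)"
      "sum_list (map area bs) = b * a - (\<Sum>i<m. (s i)\<^sup>2)"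
      "sum_list (map (girth \<delta>) bs) \<le> girth \<delta> (y, x, b, a) + s 0 powr (1 + \<delta>) +
        real m * (s 0 * (s 0 - s m) powr \<delta>)"
      using row[of s \<delta> m b a y x] assms s0 by auto
    have "\<exists>x y. map flip qs ! i = (x, y, s i, s i)" if i: "i < m" for i
    proof -
      obtain x y where "qs ! i = (x, y, s i, s i)" using *(2) i by blast
      then show ?thesis using *(1) i by simp
    qed
    moreover have "sorted_wrt sep (map flip qs @ map flip bs)"
      using *(3) by (simp add: map_append[symmetric] sorted_wrt_map del: map_append)
    moreover have "\<forall>c\<in>set (map flip qs @ map flip bs). subbrick c (x, y, a, b)"
      using *(4) subbrick_flip[of _ "(x, y, a, b)"] unfolding flip.simps by (auto simp del: subbrick.simps)
    moreover have "girth \<delta> (y, x, b, a) = girth \<delta> (x, y, a, b)"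
      using girth_flip[of \<delta> "(x, y, a, b)"] by simp
    ultimately show ?thesis using *(1,5,6)
      by (intro exI[of _ "map flip qs"] exI[of _ "map flip bs"]) (auto simp: o_def mult.commute)
  qed
qed

text \<open>A brick of largest width does it: its own area is at least the square of its width, and
  \<open>area_le_girth\<close>, summed over all bricks, bounds the total area.\<close>

lemma wide_brick:
  assumes "bs \<noteq> []" and "\<forall>c\<in>set bs. subbrick c \<Omega>" and "\<delta> < 1"
  shows "\<exists>x y a b. (x, y, a, b) \<in> set bs \<and> (min a b)\<^sup>2 \<le> sum_list (map area bs) \<and>
    sum_list (map area bs) \<le> min a b powr (1 - \<delta>) * sum_list (map (girth \<delta>) bs)"
proof -
  define width :: "brick \<Rightarrow> real" where "width = (\<lambda>(x, y, a, b). min a b)"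
  obtain c where c: "c \<in> set bs" "\<forall>d\<in>set bs. width d \<le> width c"
    using Max_in[of "width ` set bs"] Max_ge[of "width ` set bs"] assms(1)
    by (metis (no_types, lifting) finite_imageI finite_set imageE image_eqI image_is_empty set_empty)
  obtain x y a b where xy: "c = (x, y, a, b)" by (metis surj_pair)
  have nn: "0 \<le> a" "0 \<le> b" using c(1) xy assms(2) by (cases \<Omega>, force)+
  have "(min a b)\<^sup>2 \<le> area c"
    using nn xy by (auto simp: power2_eq_square min_def intro: mult_mono)
  also have "\<dots> \<le> sum_list (map area bs)"
  proof (rule member_le_sum_list)
    show "area c \<in> set (map area bs)" using c(1) by simp
    show "0 \<le> v" if "v \<in> set (map area bs)" for v
      using that assms(2) area_nonneg by (metis imageE set_map)
  qed
  finally have 1: "(min a b)\<^sup>2 \<le> sum_list (map area bs)" .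
  have "area d \<le> width c powr (1 - \<delta>) * girth \<delta> d" if d: "d \<in> set bs" for d
  proof -
    obtain x' y' a' b' where d': "d = (x', y', a', b')" by (metis surj_pair)
    have nn': "0 \<le> a'" "0 \<le> b'" using d d' assms(2) by (cases \<Omega>, force)+
    then have "area d \<le> width d powr (1 - \<delta>) * girth \<delta> d"
      using area_le_girth[of a' b' \<delta>] \<open>\<delta> < 1\<close> by (simp add: d' width_def)
    also have "\<dots> \<le> width c powr (1 - \<delta>) * girth \<delta> d"
    proof (intro mult_right_mono powr_mono2)
      show "0 \<le> width d" using nn' by (simp add: width_def d')
      show "0 \<le> girth \<delta> d" using d assms(2) girth_nonneg by blast
    qed (use c(2) d \<open>\<delta> < 1\<close> in auto)
    finally show ?thesis .
  qed
  then have "sum_list (map area bs) \<le> sum_list (map (\<lambda>d. width c powr (1 - \<delta>) * girth \<delta> d) bs)"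
    by (intro sum_list_mono)
  also have "\<dots> = width c powr (1 - \<delta>) * sum_list (map (girth \<delta>) bs)"
    by (simp add: sum_list_const_mult)
  finally show ?thesis using 1 c(1) xy by (auto simp: width_def)
qed

text \<open>Once \<open>n\<close> squares are placed, \<open>A n\<close> is the area still to be
  filled and \<open>B n\<close> the permitted total girth. The premises of \<open>step\<close> are
  what \<open>wide_brick\<close> supplies for the width \<open>w\<close>; its conclusions provide a
  row for \<open>row_in_brick\<close> and the girth bound after it.\<close>

locale greedy =
  fixes s B A :: "nat \<Rightarrow> real" and \<delta> :: real and \<Omega> :: brick
  assumes anti: "antimono s" and pos: "\<And>i. 0 < s i"
    and summable: "summable (\<lambda>i. (s i)\<^sup>2)" and \<delta>: "0 \<le> \<delta>" "\<delta> < 1"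
    and A_def: "\<And>n. A n = (\<Sum>i. (s (n + i))\<^sup>2)"
    and start: "subbrick \<Omega> \<Omega>" "area \<Omega> = A 0" "girth \<delta> \<Omega> \<le> B 0"
    and step: "\<And>n w. A n \<le> w powr (1 - \<delta>) * B n \<Longrightarrow> w\<^sup>2 \<le> A n \<Longrightarrow> 0 \<le> w \<Longrightarrow>
      \<exists>m>0. (\<Sum>i<m. s (n + i)) \<le> w \<and> w - (\<Sum>i<m. s (n + i)) \<le> s n \<and>
        B n + s n powr (1 + \<delta>) + real m * (s n * (s n - s (n + m)) powr \<delta>) \<le> B (n + m)"
begin

lemma summable_shift: "summable (\<lambda>i. (s (n + i))\<^sup>2)"
  using summable_ignore_initial_segment[OF summable, of n] by (simp add: add.commute)

lemma A_split: "A n = (\<Sum>i<m. (s (n + i))\<^sup>2) + A (n + m)"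
  using suminf_split_initial_segment[OF summable_shift, of n m] by (simp add: A_def ac_simps)

lemma A_pos: "0 < A n"
  unfolding A_def using pos by (intro suminf_pos summable_shift zero_less_power)

text \<open>The invariant of the process, with \<open>qs\<close> the placed squares and
  \<open>bs\<close> the free bricks. The free area equals exactly the area of the squares still to
  come.\<close>

definition state :: "brick list \<times> brick list \<Rightarrow> bool" where
  "state = (\<lambda>(qs, bs). (\<forall>i<length qs. \<exists>x y. qs ! i = (x, y, s i, s i)) \<and>
     sorted_wrt sep (qs @ bs) \<and> (\<forall>c\<in>set (qs @ bs). subbrick c \<Omega>) \<and>
     sum_list (map area bs) = A (length qs) \<and> sum_list (map (girth \<delta>) bs) \<le> B (length qs))"

lemma state_step:
  assumes "state (qs, bs)"
  shows "\<exists>qs' bs'. state (qs @ qs', bs') \<and> qs' \<noteq> []"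
proof -
  define n where "n = length qs"
  have *: "\<forall>i<n. \<exists>x y. qs ! i = (x, y, s i, s i)" "sorted_wrt sep (qs @ bs)"
     "\<forall>c\<in>set (qs @ bs). subbrick c \<Omega>" "sum_list (map area bs) = A n"
     "sum_list (map (girth \<delta>) bs) \<le> B n"
    using assms by (auto simp: state_def n_def)
  \<comment> \<open>The process cannot run out of bricks, because the squares to come have positive
    total area.\<close>
  have "bs \<noteq> []" using *(4) A_pos[of n] by auto
  then obtain x y a b where r: "(x, y, a, b) \<in> set bs" "(min a b)\<^sup>2 \<le> A n"
    "A n \<le> min a b powr (1 - \<delta>) * sum_list (map (girth \<delta>) bs)"
    using wide_brick[of bs \<Omega> \<delta>] *(3,4) \<delta> by auto
  have rin: "subbrick (x, y, a, b) \<Omega>" using r(1) *(3) by simp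
  have "A n \<le> min a b powr (1 - \<delta>) * B n"
    using r(3) *(5) by (meson mult_left_mono order_trans powr_ge_zero)
  moreover have "0 \<le> min a b" using rin by (cases \<Omega>) auto
  ultimately obtain m where m: "m > 0" "(\<Sum>i<m. s (n + i)) \<le> min a b"
    "min a b - (\<Sum>i<m. s (n + i)) \<le> s n"
    "B n + s n powr (1 + \<delta>) + real m * (s n * (s n - s (n + m)) powr \<delta>) \<le> B (n + m)"
    using step[of n "min a b"] r(2) by blast
  have anti': "antimono (\<lambda>i. s (n + i))" using anti by (auto simp: antimono_def)
  obtain qs' bs' where q: "length qs' = m" "\<forall>i<m. \<exists>x y. qs' ! i = (x, y, s (n + i), s (n + i))"
    "sorted_wrt sep (qs' @ bs')" "\<forall>c\<in>set (qs' @ bs'). subbrick c (x, y, a, b)"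
    "sum_list (map area bs') = a * b - (\<Sum>i<m. (s (n + i))\<^sup>2)"
    "sum_list (map (girth \<delta>) bs') \<le> girth \<delta> (x, y, a, b) + s n powr (1 + \<delta>) +
      real m * (s n * (s n - s (n + m)) powr \<delta>)"
    using row_in_brick[OF anti', of \<delta> m a b x y] pos \<delta> m(1-3) by auto
  obtain us vs where bs: "bs = us @ (x, y, a, b) # vs"
    using split_list[OF r(1)] by auto
  have "\<exists>x y. (qs @ qs') ! i = (x, y, s i, s i)" if "i < n + m" for i
    using *(1) q(1) q(2)[rule_format, of "i - n"] that by (auto simp: nth_append n_def)
  moreover have "sorted_wrt sep ((qs @ qs') @ us @ bs' @ vs)"
    using *(2) q(3,4) unfolding bs by (intro sorted_wrt_sep_replace) auto
  moreover have "\<forall>c\<in>set (qs' @ bs'). subbrick c \<Omega>"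
    using q(4) rin subbrick_trans by blast
  then have "\<forall>c\<in>set ((qs @ qs') @ us @ bs' @ vs). subbrick c \<Omega>"
    using *(3) unfolding bs by (simp add: ball_Un del: subbrick.simps)
  moreover have "sum_list (map area (us @ bs' @ vs)) = A (n + m)"
    using *(4) q(5) A_split[of n m] unfolding bs by simp
  moreover have "sum_list (map (girth \<delta>) (us @ bs' @ vs)) \<le> B (n + m)"
    using *(5) q(6) m(4) unfolding bs by simp
  ultimately have "state (qs @ qs', us @ bs' @ vs)" using q(1)
    by (simp add: state_def n_def)
  then show ?thesis using q(1) m(1) by auto
qed

text \<open>Iterating \<open>state_step\<close> gives lists of squares that grow strictly, each a
  prefix of the next; together they define an infinite sequence.\<close>

lemma placement: "\<exists>q. (\<forall>i. \<exists>x y. q i = (x, y, s i, s i)) \<and> (\<forall>i. subbrick (q i) \<Omega>) \<and>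
    (\<forall>i j. i \<noteq> j \<longrightarrow> sep (q i) (q j))"
proof -
  have "state ([], [\<Omega>])" using start by (simp add: state_def)
  moreover have "\<exists>d. state d \<and> (\<exists>qs. fst d = fst c @ qs \<and> qs \<noteq> [])" if "state c" for c
    using state_step[of "fst c" "snd c"] that by auto
  ultimately have "\<exists>f. \<forall>k. state (f k) \<and> (\<exists>qs. fst (f (Suc k)) = fst (f k) @ qs \<and> qs \<noteq> [])"
    by (intro dependent_nat_choice) auto
  then obtain f where f: "\<And>k. state (f k)"
    "\<And>k. \<exists>qs. fst (f (Suc k)) = fst (f k) @ qs \<and> qs \<noteq> []"
    by blast
  have len: "k \<le> length (fst (f k))" for k
  proof (induction k)
    case (Suc k)
    obtain qs where "fst (f (Suc k)) = fst (f k) @ qs" "qs \<noteq> []" using f(2) by blast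
    with Suc show ?case by (cases qs) auto
  qed simp
  have pre: "\<exists>qs. fst (f (k + j)) = fst (f k) @ qs" for k j
  proof (induction j)
    case (Suc j)
    then show ?case using f(2)[of "k + j"] by auto
  qed simp
  define q where "q i = fst (f (Suc i)) ! i" for i
  \<comment> \<open>By the prefix property, square \<open>i\<close> can be read off any state of
    index above \<open>i\<close>, so two squares can be compared within one common state.\<close>
  have q: "q i = fst (f k) ! i" if "i < k" for i k
  proof -
    obtain j where "k = Suc i + j" using \<open>i < k\<close> by (metis Suc_leI le_iff_add)
    then show ?thesis
      using pre[of "Suc i" j] len[of "Suc i"] by (auto simp: q_def nth_append)
  qed
  have st: "\<forall>i<length qs. \<exists>x y. qs ! i = (x, y, s i, s i)" "sorted_wrt sep qs"
    "\<forall>c\<in>set qs. subbrick c \<Omega>" if "qs = fst (f k)" for qs k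
    using f(1)[of k] that by (auto simp: state_def sorted_wrt_append split: prod.splits)
  have "\<exists>x y. q i = (x, y, s i, s i)" "subbrick (q i) \<Omega>" for i
    using st[OF refl, of "Suc i"] len[of "Suc i"] by (auto simp: q_def)
  moreover have lt: "sep (q i) (q j)" if "i < j" for i j
    using st(2)[OF refl, of "Suc j"] len[of "Suc j"] q[of i "Suc j"] q[of j "Suc j"] that
    by (auto simp: sorted_wrt_iff_nth_less)
  moreover have "sep (q i) (q j)" if "i \<noteq> j" for i j
    using lt[of i j] lt[of j i] that sep_sym by (metis linorder_neq_iff)
  ultimately show ?thesis by blast
qed

end

section \<open>Bricks as subsets of the plane\<close>

definition brick_set :: "brick \<Rightarrow> (real ^ 2) set" where
  "brick_set = (\<lambda>(x, y, a, b). cbox (vector [x, y]) (vector [x + a, y + b]))"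

lemma mem_brick_set:
  "z \<in> brick_set (x, y, a, b) \<longleftrightarrow> x \<le> z $ 1 \<and> z $ 1 \<le> x + a \<and> y \<le> z $ 2 \<and> z $ 2 \<le> y + b"
  by (auto simp: brick_set_def mem_box_cart forall_2)

lemma is_square_brick_set:
  assumes "0 < a" shows "is_square a (brick_set (x, y, a, a))"
  unfolding is_square_def
proof (intro conjI exI)
  show "norm (vector [1, 0] :: real ^ 2) = 1" "norm (vector [0, 1] :: real ^ 2) = 1"
    by (simp_all add: norm_vec_def L2_set_def sum_2)
  show "(vector [1, 0] :: real ^ 2) \<bullet> vector [0, 1] = 0" by (simp add: inner_vec_def sum_2)
  show "brick_set (x, y, a, a) = {vector [x, y] + r *\<^sub>R vector [1, 0] + t *\<^sub>R vector [0, 1] | r t.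
      r \<in> {0..a} \<and> t \<in> {0..a}}" (is "_ = ?R")
  proof (intro set_eqI iffI)
    fix z :: "real ^ 2" assume "z \<in> brick_set (x, y, a, a)"
    then show "z \<in> ?R" unfolding mem_brick_set
      by (intro CollectI exI[of _ "z $ 1 - x"] exI[of _ "z $ 2 - y"])
        (auto simp: vec_eq_iff forall_2)
  qed (auto simp: mem_brick_set)
qed (fact assms)

lemma measure_brick_set:
  assumes "0 \<le> a" "0 \<le> b"
  shows "measure lebesgue (brick_set (x, y, a, b)) = area (x, y, a, b)"
proof -
  have "vector [x, y] \<in> brick_set (x, y, a, b)" using assms by (simp add: mem_brick_set)
  then have "cbox (vector [x, y]) (vector [x + a, y + b] :: real ^ 2) \<noteq> {}"
    by (auto simp: brick_set_def)
  then show ?thesis by (simp add: brick_set_def content_cbox_cart UNIV_2)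
qed

lemma brick_set_mono: "subbrick c d \<Longrightarrow> brick_set c \<subseteq> brick_set d"
  by (cases c; cases d) (auto simp: mem_brick_set)

lemma interior_brick_set_disjoint:
  "sep c d \<Longrightarrow> interior (brick_set c) \<inter> interior (brick_set d) = {}"
  by (cases c; cases d) (auto simp: brick_set_def mem_box_cart forall_2 interior_cbox)

text \<open>The placed squares overlap only in null sets, so their union has measure
  \<open>A 0\<close>, which is the measure of the whole brick; hence the uncovered part is
  null.\<close>

lemma (in greedy) squares_pack_perfectly: "squares_pack_perfectly UNIV s (brick_set \<Omega>)"
proof -
  obtain q where q: "\<And>i. \<exists>x y. q i = (x, y, s i, s i)" "\<And>i. subbrick (q i) \<Omega>"
    "\<And>i j. i \<noteq> j \<Longrightarrow> sep (q i) (q j)"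
    using placement by blast
  define Q where "Q i = brick_set (q i)" for i
  have sq: "is_square (s i) (Q i)" for i
    using q(1)[of i] is_square_brick_set pos by (auto simp: Q_def)
  have dis: "interior (Q i) \<inter> interior (Q j) = {}" if "i \<noteq> j" for i j
    unfolding Q_def using that q(3) by (intro interior_brick_set_disjoint) auto
  have sub: "Q i \<subseteq> brick_set \<Omega>" for i unfolding Q_def using q(2) by (intro brick_set_mono)
  have meas: "brick_set c \<in> lmeasurable" for c by (cases c) (simp add: brick_set_def)
  have \<Omega>: "measure lebesgue (brick_set \<Omega>) = A 0"
    using start by (cases \<Omega>) (auto simp: measure_brick_set)
  have mQ: "measure lebesgue (Q i) = (s i)\<^sup>2" for i
    using q(1)[of i] pos[of i] by (auto simp: Q_def measure_brick_set power2_eq_square)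
  \<comment> \<open>Since the interiors are disjoint, common points lie on a frontier, and frontiers
    of convex sets are null.\<close>
  have neg: "negligible (Q i \<inter> Q j)" if "i \<noteq> j" for i j
  proof -
    have "negligible (frontier (Q i))" "negligible (frontier (Q j))"
      by (auto simp: Q_def brick_set_def split: prod.splits intro!: negligible_convex_frontier)
    then have "negligible (frontier (Q i) \<union> frontier (Q j))" by simp
    moreover have "Q i \<inter> Q j \<subseteq> frontier (Q i) \<union> frontier (Q j)"
      using dis[OF that] closure_subset by (fastforce simp: frontier_def)
    ultimately show ?thesis by (rule negligible_subset)
  qed
  have bdd: "bounded (\<Union>i. Q i)"
  proof (rule bounded_subset)
    show "bounded (brick_set \<Omega>)" by (cases \<Omega>) (simp add: brick_set_def)
    show "(\<Union>i. Q i) \<subseteq> brick_set \<Omega>" using sub by blast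
  qed
  have measQ: "Q i \<in> lmeasurable" for i unfolding Q_def by (rule meas)
  have pw: "pairwise (\<lambda>i j. negligible (Q i \<inter> Q j)) UNIV"
    using neg by (auto simp: pairwise_def)
  have U: "(\<Union>i. Q i) \<in> lmeasurable" "(\<lambda>i. (s i)\<^sup>2) sums measure lebesgue (\<Union>i. Q i)"
    using measurable_countable_negligible_Union_bounded[OF measQ pw bdd]
      measure_countable_negligible_Union_bounded[OF measQ pw bdd] mQ
    by simp_all
  then have eq: "measure lebesgue (\<Union>i. Q i) = measure lebesgue (brick_set \<Omega>)"
    using \<Omega> sums_unique by (simp add: A_def)
  have "(\<Union>i. Q i) \<subseteq> brick_set \<Omega>" using sub by blast
  from measurable_measure_Diff[OF meas fmeasurableD[OF U(1)] this]
  have "measure lebesgue (brick_set \<Omega> - (\<Union>i. Q i)) = 0" using eq by simp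
  then have "negligible (brick_set \<Omega> - (\<Union>i. Q i))"
    using meas U(1) negligible_iff_measure by blast
  then show ?thesis
    using sq sub dis by (auto simp: squares_pack_perfectly_def packed_perfectly_def packed_def pairwise_def)
qed

section \<open>A Chebyshev bound\<close>

text \<open>The numbers \<open>1 / (m * (n choose m))\<close> form Leibniz's harmonic triangle: each one is a
  difference of two entries of the previous column.\<close>

lemma mult_choose_dvd:
  assumes "1 \<le> m" "m \<le> n" and d: "\<And>i. 1 \<le> i \<Longrightarrow> i \<le> n \<Longrightarrow> i dvd d"
  shows "m * (n choose m) dvd d"
proof -
  \<comment> \<open>Integrality of the quotient is carried through the induction because it survives
    differences. The base case \<open>m = 1\<close> is \<open>n dvd d\<close>.\<close>
  have "\<exists>z::int. real d / (real m * real (n choose m)) = of_int z"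
    using assms
  proof (induction m arbitrary: n rule: dec_induct)
    case base
    then obtain k where "d = n * k" by (meson dvdE le_refl order_trans)
    with base show ?case by (intro exI[of _ "int k"]) simp
  next
    case (step m)
    obtain n' where n: "n = Suc n'" "m \<le> n'" using step.prems(1) by (cases n) auto
    obtain z1 z2 :: int where z: "real d / (real m * real (n' choose m)) = of_int z1"
      "real d / (real m * real (n choose m)) = of_int z2"
      using step.IH[of n'] step.IH[of n] step.prems n by auto
    have c: "real (n' choose m) > 0" "real (n choose m) > 0" "real m > 0"
      using step.hyps step.prems(1) n(2) by auto
    have e1: "real (Suc m) * real (n choose Suc m) = real n * real (n' choose m)"
      using Suc_times_binomial_eq[of n' m] unfolding n
      by (metis mult.commute of_nat_mult)
    have e2: "real (n choose m) * real (n - m) = real n * real (n' choose m)"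
      using binomial_absorb_comp[of n m] n by (metis diff_Suc_1 mult.commute of_nat_mult)
    have e3: "real (n - m) = real n - real m" using n by simp
    have n0: "real n > 0" "real n - real m > 0" using n by auto
    have "1 / (real (Suc m) * real (n choose Suc m)) =
        1 / (real m * real (n' choose m)) - 1 / (real m * real (n choose m))"
    proof -
      have "real (n choose m) = real n * real (n' choose m) / (real n - real m)"
        using e2 e3 n0 by (simp add: field_simps)
      then show ?thesis unfolding e1 using n0 c by (simp add: field_simps)
    qed
    then have "real d / (real (Suc m) * real (n choose Suc m)) = of_int (z1 - z2)"
      using z by (simp only: divide_inverse[of "real d"] inverse_eq_divide)
        (simp add: right_diff_distrib)
    then show ?case by blast
  qed
  then obtain z :: int where z: "real d / (real m * real (n choose m)) = of_int z" by blast
  have "real m * real (n choose m) > 0" using assms by auto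
  with z have "real d = of_int z * (real m * real (n choose m))"
    by (metis less_irrefl nonzero_divide_eq_eq)
  then have "of_int (int d) = (of_int (int (m * (n choose m)) * z) :: real)"
    by (simp add: mult.commute)
  then have "int d = int (m * (n choose m)) * z" by linarith
  then have "int (m * (n choose m)) dvd int d" by (rule dvdI)
  then show ?thesis by presburger
qed

text \<open>The exponent of a prime in a least common multiple is the largest of its exponents in
  the members.\<close>

lemma prime_power_dvd_Lcm:
  fixes p :: nat
  assumes "finite A" "prime p" "p ^ e dvd Lcm A" "0 \<notin> A" "A \<noteq> {}"
  shows "\<exists>a\<in>A. p ^ e dvd a"
  using assms(1,5,3,4)
proof (induction A rule: finite_ne_induct)
  case (insert x F)
  have x: "x \<noteq> 0" "Lcm F \<noteq> 0" using insert by (auto simp: Lcm_0_iff)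
  have "p ^ e dvd lcm x (Lcm F)" using insert by simp
  then have "e \<le> multiplicity p (lcm x (Lcm F))"
    using x assms(2) by (intro multiplicity_geI) (auto simp: lcm_eq_0_iff)
  then have "e \<le> multiplicity p x \<or> e \<le> multiplicity p (Lcm F)"
    using multiplicity_lcm[of x "Lcm F" p] x assms(2) by (auto simp: max_def split: if_splits)
  then have "p ^ e dvd x \<or> p ^ e dvd Lcm F"
    by (auto intro: multiplicity_dvd')
  with insert show ?case by auto
qed simp

text \<open>Each prime power in the factorization of the least common multiple divides some number
  up to \<open>n\<close>, so it is at most \<open>n\<close>, and there is one factor for each prime
  involved.\<close>

lemma Lcm_le_power_prime_count:
  fixes n :: nat
  assumes "1 \<le> n"
  shows "Lcm {1..n} \<le> n ^ card {p. prime p \<and> p \<le> n}"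
proof -
  define d where "d = Lcm {1..n}"
  have d0: "d \<noteq> 0" unfolding d_def using Lcm_0_iff[of "{1..n}"] by (metis atLeastAtMost_iff finite_atLeastAtMost not_one_le_zero)
  have le: "p ^ multiplicity p d \<le> n" if "prime p" for p
  proof -
    have "\<exists>a\<in>{1..n}. p ^ multiplicity p d dvd a"
      using that assms by (intro prime_power_dvd_Lcm) (auto simp: d_def multiplicity_dvd)
    then show ?thesis by (auto dest: dvd_imp_le)
  qed
  have sub: "prime_factors d \<subseteq> {p. prime p \<and> p \<le> n}"
  proof
    fix p assume p: "p \<in> prime_factors d"
    then have "prime p" "0 < multiplicity p d" by (auto simp: prime_factors_multiplicity)
    then have "p \<le> p ^ multiplicity p d" using prime_gt_0_nat[of p] by (simp add: self_le_power)
    with le[OF \<open>prime p\<close>] \<open>prime p\<close> show "p \<in> {p. prime p \<and> p \<le> n}" by simp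
  qed
  have "d = (\<Prod>p\<in>prime_factors d. p ^ multiplicity p d)"
    using prod_prime_factors[OF d0] by simp
  also have "\<dots> \<le> (\<Prod>p\<in>prime_factors d. n)"
    using le by (intro prod_mono) (auto simp: prime_factors_multiplicity)
  also have "\<dots> = n ^ card (prime_factors d)" by simp
  also have "\<dots> \<le> n ^ card {p. prime p \<and> p \<le> n}"
    using assms sub by (intro power_increasing card_mono) auto
  finally show ?thesis by (simp add: d_def)
qed

text \<open>\<open>n * (2 * n choose n)\<close> is at least \<open>4 ^ n / 2\<close> and divides
  \<open>Lcm {1..2 * n}\<close>, which has just been bounded by the number of primes.\<close>

lemma four_power_le_prime_count:
  assumes "1 \<le> n"
  shows "4 ^ n \<le> 2 * real (2 * n) ^ card {p. prime p \<and> p \<le> 2 * n}"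
proof -
  have "n * (2 * n choose n) dvd Lcm {1..2 * n}"
    using assms by (intro mult_choose_dvd) auto
  then have "n * (2 * n choose n) \<le> Lcm {1..2 * n}"
    by (intro dvd_imp_le) (auto simp: Lcm_0_iff intro!: Nat.gr0I)
  also have "\<dots> \<le> (2 * n) ^ card {p. prime p \<and> p \<le> 2 * n}"
    using assms by (intro Lcm_le_power_prime_count) simp
  finally have "real n * real (2 * n choose n) \<le> real (2 * n) ^ card {p. prime p \<and> p \<le> 2 * n}"
    by (metis of_nat_le_iff of_nat_mult of_nat_power)
  moreover have "4 ^ n \<le> 2 * (real n * real (2 * n choose n))"
    using central_binomial_lower_bound[of n] assms by (simp add: field_simps)
  ultimately show ?thesis by linarith
qed

section \<open>The size of the n-th prime\<close>

lemma nth_prime_prime: "prime (nth_prime n)"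
  using enumerate_in_set[OF primes_infinite, of "n - 1"] by (simp add: nth_prime_def)

lemma nth_prime_mono: "i \<le> j \<Longrightarrow> nth_prime i \<le> nth_prime j"
  unfolding nth_prime_def using primes_infinite by (simp add: enumerate_mono_le_iff diff_le_mono)

lemma nth_prime_ge: "n \<le> nth_prime n"
proof (cases n)
  case (Suc k)
  have "k < nth_prime (Suc k)"
  proof (induction k)
    case 0
    then show ?case using nth_prime_prime[of 1] prime_gt_0_nat by simp
  next
    case (Suc k)
    have "nth_prime (Suc k) < nth_prime (Suc (Suc k))"
      unfolding nth_prime_def using primes_infinite by (simp add: enumerate_step del: enumerate_Suc)
    with Suc show ?case by simp
  qed
  with Suc show ?thesis by simp
qed simp

lemma nth_prime_le:
  assumes "n \<le> card {p. prime p \<and> p \<le> x}" "1 \<le> n"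
  shows "nth_prime n \<le> x"
proof (rule ccontr)
  assume *: "\<not> nth_prime n \<le> x"
  define E where "E = enumerate {p::nat. prime p}"
  have "{p. prime p \<and> p \<le> x} \<subseteq> E ` {..<n - 1}"
  proof
    fix p assume p: "p \<in> {p. prime p \<and> p \<le> x}"
    then obtain i where i: "p = E i"
      using enumerate_Ex[OF primes_infinite] by (metis E_def mem_Collect_eq)
    have "E i < E (n - 1)" using p * i by (auto simp: nth_prime_def E_def[symmetric])
    then have "i < n - 1" unfolding E_def using enumerate_mono_iff[OF primes_infinite] by blast
    with i show "p \<in> E ` {..<n - 1}" by simp
  qed
  from card_mono[OF _ this] card_image_le[of "{..<n - 1}" E]
  have "card {p. prime p \<and> p \<le> x} \<le> n - 1" by simp
  with assms show False by simp
qed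

text \<open>If there were fewer than \<open>2 * n\<close> primes up to \<open>2 * N\<close>, with
  \<open>N\<close> about \<open>9 / 2 * n * L\<close>, then
  \<open>4 ^ N \<le> (2 * N) ^ (2 * n)\<close>. Taking logarithms gives
  \<open>N * ln 4 \<le> 4 * n * L\<close>, which contradicts \<open>N \<ge> 4 * n * L\<close> and
  \<open>ln 4 > 1\<close>.\<close>

lemma nth_prime_double_le:
  assumes "256 \<le> ln (real n)"
  shows "real (nth_prime (2 * n)) \<le> 9 * real n * ln (real n)"
proof -
  define L where "L = ln (real n)"
  have n0: "n > 0" using assms by (cases n) auto
  define N where "N = nat \<lfloor>9 / 2 * real n * L\<rfloor>"
  have L: "L \<ge> 256" using assms by (simp add: L_def)
  have "real n * L \<ge> 1 * 256" using n0 L by (intro mult_mono) auto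
  \<comment> \<open>The room between 4 and 9/2 absorbs the rounding.\<close>
  then have N: "real N \<le> 9 / 2 * real n * L" "real N \<ge> 4 * real n * L" "N \<ge> 1"
    unfolding N_def by linarith+
  have "2 * n \<le> card {p. prime p \<and> p \<le> 2 * N}"
  proof (rule ccontr)
    assume "\<not> ?thesis"
    then have c: "Suc (card {p. prime p \<and> p \<le> 2 * N}) \<le> 2 * n" by simp
    have "4 ^ N \<le> 2 * real (2 * N) ^ card {p. prime p \<and> p \<le> 2 * N}"
      using N(3) by (rule four_power_le_prime_count)
    \<comment> \<open>The factor 2 is absorbed by one more factor \<open>2 * N\<close>; the strict
      inequality in the assumption leaves room for it.\<close>
    also have "\<dots> \<le> real (2 * N) ^ Suc (card {p. prime p \<and> p \<le> 2 * N})"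
      using N(3) by (auto intro!: mult_right_mono)
    also have "\<dots> \<le> real (2 * N) ^ (2 * n)" using c N(3) by (intro power_increasing) auto
    finally have "ln (4 ^ N) \<le> ln (real (2 * N) ^ (2 * n))" using N(3) by (subst ln_le_cancel_iff) auto
    then have 1: "real N * ln 4 \<le> 2 * real n * ln (2 * real N)"
      using N(3) ln_realpow[of 4 N] ln_realpow[of "real (2 * N)" "2 * n"] by simp
    have "ln (2 * real N) \<le> ln (9 * real n * L)" using N n0 L by (subst ln_le_cancel_iff) auto
    also have "\<dots> = ln (9 * L) + L" using n0 L by (simp add: ln_mult L_def)
    also have "ln (9 * L) \<le> L"
    proof -
      have "256 * L \<le> L * L" using L by (intro mult_right_mono) auto
      moreover have "(1 + L / 2) ^ 2 = 1 + L + L * L / 4"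
        by (simp add: power2_eq_square algebra_simps)
      ultimately have "9 * L \<le> (1 + L / 2) ^ 2" using L by linarith
      also have "\<dots> \<le> exp (L / 2) ^ 2" using L by (intro power_mono) auto
      also have "\<dots> = exp L" by (simp add: exp_double[symmetric])
      finally show ?thesis using L ln_le_cancel_iff[of "9 * L" "exp L"] by simp
    qed
    finally have "real n * ln (2 * real N) \<le> real n * (2 * L)" by (intro mult_left_mono) auto
    with 1 have 2: "real N * ln 4 \<le> 4 * (real n * L)" by simp
    have "ln (4::real) > 1"
      using exp_le ln_less_cancel_iff[of "exp 1" "4::real"] by simp
    then have "real N * 1 < real N * ln 4" using N(3) by (intro mult_strict_left_mono) auto
    with 2 have "real N < 4 * (real n * L)" by linarith
    with N(2) show False by simp
  qed
  then have "nth_prime (2 * n) \<le> 2 * N" using n0 by (intro nth_prime_le) auto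
  then have "real (nth_prime (2 * n)) \<le> 2 * real N" by linarith
  with N(1) show ?thesis by (simp add: L_def)
qed

section \<open>The sidelengths of the primes\<close>

lemma ln_power_le_exp:
  assumes "256 \<le> (L::real)"
  shows "9 * L * sqrt L \<le> exp (L / 8)"
proof -
  have "16 \<le> sqrt L" using assms real_le_rsqrt[of 16 L] by simp
  then have "16 * sqrt L \<le> sqrt L * sqrt L" using assms by (intro mult_right_mono) auto
  then have "sqrt L \<le> L / 16" using assms real_sqrt_mult_self[of L] by simp
  then have "9 * L * sqrt L \<le> 9 * L * (L / 16)" using assms by (intro mult_left_mono) auto
  \<comment> \<open>Prepares for \<open>1 + L / 64 \<ge> 5\<close>, so that an eighth power of
    \<open>1 + L / 64\<close> appears.\<close>
  also have "\<dots> \<le> (L / 64) ^ 2 * 5 ^ 6" by (simp add: power2_eq_square)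
  also have "\<dots> \<le> (1 + L / 64) ^ 2 * (1 + L / 64) ^ 6"
    using assms by (intro mult_mono power_mono) auto
  also have "\<dots> = (1 + L / 64) ^ 8" by (simp flip: power_add)
  also have "\<dots> \<le> exp (L / 64) ^ 8" using assms by (intro power_mono) auto
  also have "\<dots> = exp (L / 8)" by (simp flip: exp_of_nat_mult)
  finally show ?thesis .
qed

text \<open>After taking logarithms and substituting \<open>v = 1 / (2 * u)\<close> and
  \<open>z = L * u ^ 4 / 16\<close>, the right-hand side becomes \<open>16 * v * z\<close>. On the
  left, tangent bounds for \<open>ln v\<close> and \<open>ln z\<close> suffice, as
  \<open>z \<ge> 1\<close>.\<close>

lemma polylog_le_exp:
  fixes u L :: real
  assumes u: "0 < u" "u \<le> 1 / 2" and L: "16 / u ^ 4 \<le> L"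
  shows "24 / u\<^sup>2 * (9 * L) powr (2 * (1 - u)) \<le> exp (u ^ 3 / 2 * L)"
proof -
  define v z where "v = 1 / (2 * u)" and "z = L * u ^ 4 / 16"
  have z: "1 \<le> z" using L u by (simp add: z_def field_simps)
  have L0: "0 < L" using z u unfolding z_def
    by (metis divide_pos_pos L less_le_trans zero_less_numeral zero_less_power)
  have Lz: "L = 16 * z / u ^ 4" using u by (simp add: z_def)
  have ln2: "ln (2::real) \<le> 7 / 10" using ln2_le_25_over_36 by simp
  have "ln (32::real) = 5 * ln 2" using ln_realpow[of 2 5] by simp
  moreover have "ln (24::real) \<le> ln 32" by simp
  ultimately have ln24: "ln (24::real) \<le> 7 / 2" using ln2 by linarith
  have "ln (256::real) = 8 * ln 2" using ln_realpow[of 2 8] by simp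
  moreover have "ln (144::real) \<le> ln 256" by simp
  ultimately have ln144: "ln (144::real) \<le> 28 / 5" using ln2 by linarith
  have "ln v \<le> v - 1" using u by (intro ln_le_minus_one) (simp add: v_def)
  moreover have "ln v = - ln 2 - ln u" using u by (simp add: v_def ln_div ln_mult)
  ultimately have lnu: "- ln u \<le> v - 3 / 10" using ln2 by linarith
  have lnz: "ln z \<le> z - 1" using z by (intro ln_le_minus_one) simp
  have lnL: "ln (9 * L) = ln 144 + ln z - 4 * ln u"
  proof -
    have "9 * L = 144 * z / u ^ 4" using Lz by simp
    then show ?thesis using z u by (simp add: ln_div ln_mult ln_realpow)
  qed
  have "4 * - ln u \<le> 4 * (v - 3 / 10)" using lnu by (intro mult_left_mono) auto
  then have "ln (9 * L) \<le> 28 / 5 + (z - 1) + 4 * (v - 3 / 10)"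
    unfolding lnL using ln144 lnz by linarith
  then have lnp: "2 * (1 - u) * ln (9 * L) \<le> 2 * (1 - u) * (28 / 5 + (z - 1) + 4 * (v - 3 / 10))"
    using u by (intro mult_left_mono) auto
  have "ln (24 / u\<^sup>2 * (9 * L) powr (2 * (1 - u))) =
      ln 24 + 2 * (- ln u) + 2 * (1 - u) * ln (9 * L)"
    using u L0 by (simp add: ln_mult ln_div ln_realpow ln_powr)
  also have "\<dots> \<le> 7 / 2 + 2 * (v - 3 / 10) + 2 * (1 - u) * (28 / 5 + (z - 1) + 4 * (v - 3 / 10))"
    by (rule add_mono[OF add_mono[OF ln24 mult_left_mono[OF lnu]] lnp]) simp
  also have "\<dots> = 77 / 10 + 10 * v - 44 / 5 * u + 2 * (1 - u) * (z - 1)"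
  proof -
    have "u * v = 1 / 2" using u by (simp add: v_def)
    moreover have "7 / 2 + 2 * (v - 3 / 10) + 2 * (1 - u) * (28 / 5 + (z - 1) + 4 * (v - 3 / 10)) =
      117 / 10 + 10 * v - 44 / 5 * u - 8 * (u * v) + 2 * (1 - u) * (z - 1)"
      by (simp add: field_simps)
    ultimately show ?thesis by simp
  qed
  also have "\<dots> \<le> 16 * v + 2 * (1 - u) * (z - 1)"
  proof -
    \<comment> \<open>The quadratic \<open>77 / 10 * u - 44 / 5 * u^2\<close> is largest at
      \<open>u = 7 / 16\<close>.\<close>
    have "0 \<le> (u - 7 / 16)\<^sup>2" by simp
    then have "77 / 10 * u - 44 / 5 * (u * u) \<le> 3" by (simp add: power2_eq_square algebra_simps)
    then have "(77 / 10 - 44 / 5 * u) * u \<le> 3" by (simp add: algebra_simps)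
    then have "77 / 10 - 44 / 5 * u \<le> 3 / u" using u by (simp add: le_divide_eq)
    then show ?thesis by (simp add: v_def)
  qed
  also have "\<dots> \<le> 16 * v + 16 * v * (z - 1)"
  proof -
    have "1 \<le> v" using u by (simp add: v_def)
    then have "2 * (1 - u) * (z - 1) \<le> 16 * v * (z - 1)"
      using z u by (intro mult_right_mono) auto
    then show ?thesis by simp
  qed
  also have "\<dots> = u ^ 3 / 2 * L" using u unfolding Lz v_def
    by (simp add: field_simps power_numeral_reduce)
  finally have "exp (ln (24 / u\<^sup>2 * (9 * L) powr (2 * (1 - u)))) \<le> exp (u ^ 3 / 2 * L)" by simp
  then show ?thesis using u L0 by (subst (asm) exp_ln) auto
qed

text \<open>A Bernoulli inequality that also covers exponents below 1, from
  \<open>ln (1 + r) \<ge> r / (1 + r) \<ge> r / 2\<close>.\<close>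

lemma one_plus_powr_ge:
  assumes "0 \<le> r" "r \<le> 1" "0 \<le> (e::real)"
  shows "1 + e * r / 2 \<le> (1 + r) powr e"
proof -
  have "ln (1 / (1 + r)) \<le> 1 / (1 + r) - 1" using assms by (intro ln_le_minus_one) auto
  then have "r / (1 + r) \<le> ln (1 + r)" using assms by (simp add: ln_div field_simps)
  moreover have "r / 2 \<le> r / (1 + r)" using assms by (intro divide_left_mono) auto
  ultimately have "r / 2 \<le> ln (1 + r)" by (rule order_trans[rotated])
  then have "e * (r / 2) \<le> e * ln (1 + r)" using assms by (intro mult_left_mono) auto
  also have "1 + \<dots> \<le> exp (e * ln (1 + r))" by (rule exp_ge_add_one_self)
  finally show ?thesis using assms by (simp add: powr_def)
qed

text \<open>The right-hand side is the integral of \<open>x^(-p - 1)\<close> from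
  \<open>k - 1\<close> to \<open>k\<close>; the proof uses only \<open>ln (1 - r) \<le> - r\<close>
  and \<open>exp y \<ge> 1 + y\<close>.\<close>

lemma powr_minus_le_telescope:
  assumes "1 < (k::real)" "0 < p"
  shows "k powr (- p - 1) \<le> ((k - 1) powr - p - k powr - p) / p"
proof -
  define r where "r = 1 / k"
  have r: "0 < r" "r < 1" using assms by (auto simp: r_def)
  have "ln (1 - r) \<le> (1 - r) - 1" using r by (intro ln_le_minus_one) auto
  then have "p * r \<le> p * - ln (1 - r)" using assms by (intro mult_left_mono) auto
  also have "1 + \<dots> \<le> exp (p * - ln (1 - r))" by (rule exp_ge_add_one_self)
  finally have "1 + p * r \<le> (1 - r) powr - p" using r by (simp add: powr_def)
  then have "k powr - p * (1 + p * r) \<le> k powr - p * (1 - r) powr - p" by (intro mult_left_mono) auto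
  also have "\<dots> = (k * (1 - r)) powr - p" using assms r by (simp add: powr_mult)
  also have "k * (1 - r) = k - 1" using assms by (simp add: r_def field_simps)
  finally have "k powr - p + p * (k powr - p * r) \<le> (k - 1) powr - p" by (simp add: algebra_simps)
  moreover have "k powr - p * r = k powr (- p - 1)" using assms by (simp add: r_def powr_diff)
  ultimately show ?thesis using assms by (simp add: field_simps)
qed

section \<open>Areas, row lengths and girths for prime sidelengths\<close>

locale prime_sides =
  fixes t u :: real
  assumes t: "1 / 2 < t" "t < 1" and u_def: "u = 1 - t"
begin

definition s :: "nat \<Rightarrow> real" where "s n = real (nth_prime n) powr - t"

definition A :: "nat \<Rightarrow> real" where "A n = (\<Sum>i. (s (n + i))\<^sup>2)"

text \<open>The bound on the total girth when the \<open>n\<close>-th prime is next. Subtracting the second term pays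
  for the slivers: it decreases as \<open>s\<close> drops, however irregular the drops are.\<close>

definition B :: "nat \<Rightarrow> real" where
  "B n = 12 / u\<^sup>2 * real n powr (u\<^sup>2 / 2) - real n powr (3 / 4 - t * u) * s n"

text \<open>The first inequality is the premise of \<open>polylog_le_exp\<close> for
  \<open>L = ln n\<close>; the second lets a logarithm absorb the constant
  \<open>1 / (2 * t - 1)\<close> of the tail sum in \<open>A_le\<close>.\<close>

definition large :: "nat \<Rightarrow> bool" where
  "large n \<longleftrightarrow> 16 / u ^ 4 \<le> ln (real n) \<and> 1 / (2 * t - 1) \<le> u * ln (real n)"

lemma u: "0 < u" "u < 1 / 2" "t = 1 - u" using t u_def by auto

lemma u_sq: "u\<^sup>2 / 2 \<le> 1 / 8" "0 < u\<^sup>2"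
proof -
  have "u\<^sup>2 \<le> (1 / 2)\<^sup>2" using u by (intro power_mono) auto
  then show "u\<^sup>2 / 2 \<le> 1 / 8" by (simp add: power2_eq_square)
qed (use u in simp)

lemma largeD:
  assumes "large n"
  shows "256 \<le> ln (real n)" "1 < real n"
proof -
  have "u ^ 4 \<le> (1 / 2) ^ 4" using u by (intro power_mono) auto
  then have "256 * u ^ 4 \<le> 16" by (simp add: power_numeral_reduce)
  then have "256 \<le> 16 / u ^ 4" using u by (simp add: le_divide_eq)
  then show *: "256 \<le> ln (real n)" using assms by (simp add: large_def)
  show "1 < real n"
  proof (rule ccontr)
    assume "\<not> 1 < real n"
    then have "n = 0 \<or> n = 1" by auto
    with * show False by auto
  qed
qed

lemma large_mono:
  assumes "large n" "n \<le> k" shows "large k"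
proof -
  have "ln (real n) \<le> ln (real k)" using largeD[OF assms(1)] assms(2) by (subst ln_le_cancel_iff) auto
  then have "u * ln (real n) \<le> u * ln (real k)" using u by (intro mult_left_mono) auto
  then show ?thesis using \<open>ln (real n) \<le> ln (real k)\<close> assms(1) by (auto simp: large_def)
qed

lemma s_pos: "0 < s n"
  using nth_prime_prime[of n] prime_gt_0_nat by (simp add: s_def)

lemma s_anti: "i \<le> j \<Longrightarrow> s j \<le> s i"
  unfolding s_def using nth_prime_mono[of i j] nth_prime_prime[of i] t prime_gt_0_nat[of "nth_prime i"]
  by (intro powr_mono2') auto

lemma s_le: "0 < n \<Longrightarrow> s n \<le> real n powr - t"
  unfolding s_def using nth_prime_ge[of n] t by (intro powr_mono2') auto

lemma s_double_ge:
  assumes "large n" shows "(9 * real n * ln (real n)) powr - t \<le> s (2 * n)"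
  unfolding s_def using nth_prime_double_le[OF largeD(1)[OF assms]] t
    prime_gt_0_nat[OF nth_prime_prime[of "2 * n"]] by (intro powr_mono2') auto

lemma s_sq_le: "0 < n \<Longrightarrow> (s n)\<^sup>2 \<le> real n powr (- 2 * t)"
proof -
  assume "0 < n"
  then have "(s n)\<^sup>2 \<le> (real n powr - t)\<^sup>2" using s_le[of n] s_pos[of n] by (intro power_mono) auto
  also have "\<dots> = real n powr (- 2 * t)" by (simp add: power2_eq_square flip: powr_add)
  finally show ?thesis .
qed

lemma summable_s_sq: "summable (\<lambda>n. (s n)\<^sup>2)"
proof (rule summable_comparison_test')
  show "summable (\<lambda>n. real n powr (- 2 * t))" using t by (subst summable_real_powr_iff) auto
  show "norm ((s n)\<^sup>2) \<le> real n powr (- 2 * t)" if "1 \<le> n" for n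
    using s_sq_le[of n] that by simp
qed

lemma summable_s_sq': "summable (\<lambda>i. (s (n + i))\<^sup>2)"
  using summable_ignore_initial_segment[OF summable_s_sq, of n] by (simp add: add.commute)

lemma A_pos: "0 < A n"
  unfolding A_def using s_pos by (intro suminf_pos summable_s_sq' zero_less_power)

text \<open>Only the first \<open>n\<close> terms are kept, and each is at least
  \<open>(s (2 * n))^2\<close>, which the Chebyshev bound controls.\<close>

lemma A_ge:
  assumes "large n"
  shows "real n powr (1 - 2 * t) / (9 * ln (real n)) powr (2 * t) \<le> A n"
proof -
  have n: "1 < real n" "256 \<le> ln (real n)" using largeD[OF assms] by auto
  have "real n powr (1 - 2 * t) / (9 * ln (real n)) powr (2 * t) =
      real n * ((9 * real n * ln (real n)) powr - t)\<^sup>2"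
  proof -
    have "((9 * real n * ln (real n)) powr - t)\<^sup>2 = (real n * (9 * ln (real n))) powr (- (2 * t))"
      by (simp add: power2_eq_square mult.commute mult.left_commute flip: powr_add)
    then show ?thesis using n by (simp add: powr_mult powr_minus powr_diff divide_simps)
  qed
  also have "\<dots> \<le> real n * (s (2 * n))\<^sup>2"
    using s_double_ge[OF assms] by (intro mult_left_mono power_mono) auto
  also have "\<dots> = (\<Sum>i<n. (s (2 * n))\<^sup>2)" by simp
  also have "\<dots> \<le> (\<Sum>i<n. (s (n + i))\<^sup>2)"
    using s_anti s_pos by (intro sum_mono power_mono) (auto intro: less_imp_le)
  also have "\<dots> \<le> A n" unfolding A_def by (intro sum_le_suminf summable_s_sq') auto
  finally show ?thesis .
qed

text \<open>From \<open>p\<^sub>k \<ge> k\<close> the tail is at most a telescoping sum with value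
  \<open>(n - 1)^(-p) / p\<close>, where \<open>p = 2 * t - 1\<close>. Passing from
  \<open>n - 1\<close> to \<open>n\<close> costs at most a factor 2, and
  \<open>2 / p \<le> 2 * u * ln n \<le> ln n\<close>.\<close>

lemma A_le:
  assumes "large n" shows "A n \<le> real n powr (1 - 2 * t) * ln (real n)"
proof -
  have n: "1 < real n" "256 \<le> ln (real n)" using largeD[OF assms] by auto
  define p where "p = 2 * t - 1"
  have p: "0 < p" "p < 1" using t by (auto simp: p_def)
  define G where "G k = (real k - 1) powr - p / p" for k
  have "(\<Sum>i<k. (s (n + i))\<^sup>2) \<le> G n - G (n + k)" for k
  proof (induction k)
    case (Suc k)
    have "(s (n + k))\<^sup>2 \<le> real (n + k) powr (- p - 1)"
      using s_sq_le[of "n + k"] n by (simp add: p_def)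
    also have "\<dots> \<le> G (n + k) - G (n + Suc k)"
      using powr_minus_le_telescope[of "real (n + k)" p] n p by (simp add: G_def diff_divide_distrib)
    finally show ?case using Suc by simp
  qed simp
  also have "G n - G (n + k) \<le> G n" for k using p by (simp add: G_def)
  finally have "A n \<le> G n" unfolding A_def by (intro suminf_le_const summable_s_sq')
  also have "\<dots> \<le> (real n / 2) powr - p / p"
    unfolding G_def using n p by (intro divide_right_mono powr_mono2') auto
  also have "\<dots> = 2 powr p * real n powr - p / p"
    using n by (simp add: powr_divide powr_minus field_simps)
  also have "\<dots> \<le> 2 powr 1 * real n powr - p / p"
    using p by (intro divide_right_mono mult_right_mono powr_mono) auto
  also have "\<dots> = real n powr - p * (2 * (1 / p))" by simp
  also have "\<dots> \<le> real n powr - p * (2 * (u * ln (real n)))"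
    using assms by (intro mult_left_mono) (auto simp: large_def p_def)
  also have "\<dots> \<le> real n powr - p * ln (real n)"
    using u n by (intro mult_left_mono) auto
  finally show ?thesis by (simp add: p_def)
qed

lemma polylog_le:
  assumes "large n"
  shows "9 * ln (real n) * sqrt (ln (real n)) \<le> real n powr (1 / 8)"
  using ln_power_le_exp[of "ln (real n)"] largeD[OF assms] by (simp add: powr_def)

text \<open>Without logarithms the quotient of \<open>sqrt (A n)\<close> and
  \<open>s (2 * n)\<close> is of order \<open>n^(1/2)\<close>; the logarithms cost a further
  \<open>n^(1/8)\<close>. This limits the number of squares in a row.\<close>

lemma sqrt_A_le:
  assumes "large n" shows "sqrt (A n) \<le> real n powr (5 / 8) * s (2 * n)"
proof -
  define L where "L = ln (real n)"
  have n: "1 < real n" "256 \<le> L" using largeD[OF assms] by (auto simp: L_def)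
  have "sqrt (A n) \<le> sqrt (real n powr (1 - 2 * t) * L)"
    using A_le[OF assms] by (simp add: L_def)
  also have "\<dots> = real n powr (1 / 2 - t) * sqrt L"
    using n by (simp add: real_sqrt_mult powr_half_sqrt[symmetric] powr_powr diff_divide_distrib)
  also have "\<dots> = real n powr (1 / 2 - t) * (9 * L * sqrt L) / (9 * L)" using n by simp
  also have "\<dots> \<le> real n powr (1 / 2 - t) * real n powr (1 / 8) / (9 * L)"
    using polylog_le[OF assms] n unfolding L_def
    by (intro divide_right_mono mult_left_mono) auto
  also have "\<dots> = real n powr (5 / 8) * (real n powr - t * (9 * L) powr - 1)"
  proof -
    have "real n powr (1 / 2 - t) * real n powr (1 / 8) = real n powr (5 / 8) * real n powr - t"
      by (simp flip: powr_add)
    then show ?thesis using n by (simp add: powr_minus_divide)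
  qed
  also have "\<dots> \<le> real n powr (5 / 8) * (real n powr - t * (9 * L) powr - t)"
    using n t by (intro mult_left_mono powr_mono) auto
  also have "real n powr - t * (9 * L) powr - t = (9 * real n * L) powr - t"
    using n by (simp add: powr_mult)
  also have "real n powr (5 / 8) * \<dots> \<le> real n powr (5 / 8) * s (2 * n)"
    using s_double_ge[OF assms] by (intro mult_left_mono) (auto simp: L_def)
  finally show ?thesis .
qed

text \<open>The row takes as many squares as fit. They number at most \<open>n^(5/8)\<close>, since
  each has side at least \<open>s (2 * n)\<close>, and they are many, since each has side at most
  \<open>s n\<close>.\<close>

lemma row_length:
  assumes "large n" "0 \<le> w" "w\<^sup>2 \<le> A n" "2 * real n powr (u\<^sup>2 / 2) * s n \<le> w"
  shows "\<exists>m>0. (\<Sum>i<m. s (n + i)) \<le> w \<and> w - (\<Sum>i<m. s (n + i)) \<le> s n \<and>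
    real n powr (u\<^sup>2 / 2) \<le> real m \<and> real m \<le> real n powr (5 / 8)"
proof -
  have n: "1 < real n" using largeD[OF assms(1)] by simp
  define S where "S k = (\<Sum>i<k. s (n + i))" for k
  have S_ge: "real k * s (2 * n) \<le> S k" if "k \<le> n" for k
  proof -
    have "(\<Sum>i<k. s (2 * n)) \<le> S k" unfolding S_def using that by (intro sum_mono s_anti) auto
    then show ?thesis by simp
  qed
  have S_le: "S k \<le> real k * s n" for k
  proof -
    have "S k \<le> (\<Sum>i<k. s n)" unfolding S_def by (intro sum_mono s_anti) auto
    then show ?thesis by simp
  qed
  have "w \<le> sqrt (A n)" using assms(3) by (rule real_le_rsqrt)
  also note sqrt_A_le[OF assms(1)]
  finally have w: "w \<le> real n powr (5 / 8) * s (2 * n)" .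
  \<comment> \<open>So \<open>n\<close> squares overflow the row; hence \<open>k\<close> below
    exists, and the row only uses indices for which \<open>s (2 * n)\<close> is a lower
    bound.\<close>
  also have "real n powr (5 / 8) < real n powr 1" using n by (intro powr_less_mono) auto
  then have "real n powr (5 / 8) * s (2 * n) < real n * s (2 * n)"
    using s_pos n by simp
  also have "\<dots> \<le> S n" by (rule S_ge) simp
  finally have "w < S n" .
  define k where "k = (LEAST k. w < S k)"
  have k: "w < S k" "k \<le> n" using \<open>w < S n\<close> unfolding k_def by (auto intro: LeastI Least_le)
  have "k \<noteq> 0"
  proof
    assume "k = 0"
    then show False using k(1) assms(2) by (simp add: S_def)
  qed
  then obtain m where m: "k = Suc m" by (cases k) auto
  have "S m \<le> w" using not_less_Least[of m "\<lambda>k. w < S k"] m by (simp add: k_def)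
  have "w \<le> S m + s n" using k(1) s_anti[of n "n + m"] by (simp add: m S_def)
  have "real m * s (2 * n) \<le> real n powr (5 / 8) * s (2 * n)"
    using S_ge[of m] k(2) m \<open>S m \<le> w\<close> w by simp
  then have "real m \<le> real n powr (5 / 8)" using s_pos by simp
  have one: "1 \<le> real n powr (u\<^sup>2 / 2)" using n u by (intro ge_one_powr_ge_zero) auto
  have "S k \<le> real (Suc m) * s n" using S_le[of k] unfolding m .
  then have "2 * real n powr (u\<^sup>2 / 2) * s n < real (Suc m) * s n"
    using assms(4) k(1) by linarith
  then have "2 * real n powr (u\<^sup>2 / 2) < real m + 1" using s_pos[of n]
    by (subst (asm) mult_less_cancel_right_pos) auto
  with one have "real n powr (u\<^sup>2 / 2) \<le> real m" by simp
  with one have "m > 0" by (cases m) auto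
  show ?thesis
    using \<open>m > 0\<close> \<open>S m \<le> w\<close> \<open>w \<le> S m + s n\<close> \<open>real n powr (u\<^sup>2 / 2) \<le> real m\<close>
      \<open>real m \<le> real n powr (5 / 8)\<close> by (auto simp: S_def)
qed

text \<open>For a narrower brick, \<open>w^t * B n\<close> would be below
  \<open>24 / u^2 * n^(1 - 2 * t - u^3 / 2)\<close>. Compared with \<open>A_ge\<close> a factor
  \<open>n^(u^3 / 2)\<close> is missing, which outweighs the logarithms by
  \<open>polylog_le_exp\<close>.\<close>

lemma width_ge:
  assumes "large n" "0 \<le> w" "A n \<le> w powr t * B n"
  shows "2 * real n powr (u\<^sup>2 / 2) * s n \<le> w"
proof (rule ccontr)
  define x e L where "x = real n" and "e = u\<^sup>2 / 2" and "L = ln x"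
  assume "\<not> ?thesis"
  then have w: "w \<le> 2 * x powr e * s n" by (simp add: x_def e_def)
  have x: "1 < x" "256 \<le> L" using largeD[OF assms(1)] by (auto simp: x_def L_def)
  have "s n \<le> x powr - t" using s_le[of n] x by (simp add: x_def)
  then have "w \<le> 2 * x powr e * x powr - t" using w by (meson mult_left_mono order_trans powr_ge_zero zero_le_mult_iff zero_le_numeral)
  then have "w powr t \<le> (2 * x powr (e - t)) powr t"
    using assms(2) t by (intro powr_mono2) (auto simp: powr_diff powr_minus divide_simps)
  also have "\<dots> = 2 powr t * x powr ((e - t) * t)" by (simp add: powr_mult powr_powr)
  also have "\<dots> \<le> 2 powr 1 * x powr ((e - t) * t)" using t by (intro mult_right_mono powr_mono) auto
  finally have wt: "w powr t \<le> 2 * x powr ((e - t) * t)" by simp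
  have "0 < w powr t * B n" using A_pos[of n] assms(3) by linarith
  then have "0 \<le> B n" by (metis less_le_not_le linorder_le_cases mult_nonneg_nonpos powr_ge_zero)
  have "B n < 12 / u\<^sup>2 * x powr e" using s_pos[of n] x by (simp add: B_def x_def e_def)
  have "A n \<le> w powr t * B n" by fact
  also have "\<dots> \<le> 2 * x powr ((e - t) * t) * B n" using wt \<open>0 \<le> B n\<close> by (rule mult_right_mono)
  also have "\<dots> < 2 * x powr ((e - t) * t) * (12 / u\<^sup>2 * x powr e)"
    using \<open>B n < _\<close> x by (intro mult_strict_left_mono) auto
  also have "\<dots> = 24 / u\<^sup>2 * x powr ((e - t) * t + e)" by (simp add: powr_add)
  also have "(e - t) * t + e = 1 - 2 * t - u ^ 3 / 2"
    by (simp add: u(3) e_def power2_eq_square power3_eq_cube field_simps)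
  also have "24 / u\<^sup>2 * x powr (1 - 2 * t - u ^ 3 / 2) = x powr (1 - 2 * t) * (24 / u\<^sup>2 / x powr (u ^ 3 / 2))"
    unfolding powr_diff[of x "1 - 2 * t" "u ^ 3 / 2"] by simp
  also have "\<dots> \<le> x powr (1 - 2 * t) * (1 / (9 * L) powr (2 * t))"
  proof (intro mult_left_mono)
    have "24 / u\<^sup>2 * (9 * L) powr (2 * t) \<le> x powr (u ^ 3 / 2)"
    proof -
      have "16 / u ^ 4 \<le> L" using assms(1) by (simp add: large_def L_def x_def)
      from polylog_le_exp[OF u(1) _ this] show ?thesis using u x by (simp add: powr_def L_def)
    qed
    from divide_right_mono[OF this, of "x powr (u ^ 3 / 2) * (9 * L) powr (2 * t)"]
    show "24 / u\<^sup>2 / x powr (u ^ 3 / 2) \<le> 1 / (9 * L) powr (2 * t)"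
      using x by simp
  qed simp
  also have "\<dots> \<le> A n" using A_ge[OF assms(1)] by (simp add: x_def L_def)
  finally show False by simp
qed

text \<open>The first term of \<open>B\<close> grows by at least three units of
  \<open>m * x^(e - 1)\<close>. They pay for the end piece (\<open>a\<close>), for slivers when the
  sidelength drops little (\<open>b\<close>), and for the growth of the weight \<open>x^g\<close> in
  the second term (\<open>c\<close>). Slivers after a large drop \<open>D\<close> are paid by the
  decrease \<open>x^g * D\<close> of the subtracted term.\<close>

lemma B_step:
  assumes "large n" "real n powr (u\<^sup>2 / 2) \<le> real m" "real m \<le> real n powr (5 / 8)"
  shows "B n + s n powr (1 + u) + real m * (s n * (s n - s (n + m)) powr u) \<le> B (n + m)"
proof -
  define x e g y y' where "x = real n" and "e = u\<^sup>2 / 2" and "g = 3 / 4 - t * u"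
    and "y = s n" and "y' = s (n + m)"
  define D where "D = y - y'"
  have x: "1 < x" using largeD[OF assms(1)] by (auto simp: x_def)
  have y: "0 < y" "0 < y'" "y' \<le> y" "y \<le> x powr - t" using s_pos s_anti s_le x
    by (auto simp: y_def y'_def x_def)
  have m: "x powr e \<le> real m" "real m \<le> x powr (5 / 8)" using assms by (auto simp: x_def e_def)
  have tu: "t * (1 + u) = 1 - 2 * e" by (simp add: u(3) e_def power2_eq_square algebra_simps)
  have e: "0 < e" "e \<le> 1 / 8" using u_sq by (auto simp: e_def)
  have ut: "0 < u * t" "u * t \<le> 1 / 4"
  proof -
    have "0 \<le> (u - 1 / 2)\<^sup>2" by simp
    then show "u * t \<le> 1 / 4" by (simp add: u(3) power2_eq_square algebra_simps)
  qed (use u t in auto)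
  have y1: "y powr (1 + u) \<le> x powr (2 * e - 1)"
  proof -
    have "y powr (1 + u) \<le> (x powr - t) powr (1 + u)" using y u by (intro powr_mono2) auto
    also have "\<dots> = x powr (2 * e - 1)"
    proof -
      have "- t * (1 + u) = 2 * e - 1" using tu by simp
      then show ?thesis unfolding powr_powr by simp
    qed
    finally show ?thesis .
  qed
  have a': "x powr - e * y powr (1 + u) \<le> x powr (e - 1)"
  proof -
    have "x powr - e * y powr (1 + u) \<le> x powr - e * x powr (2 * e - 1)"
      using y1 by (intro mult_left_mono) auto
    then show ?thesis by (simp flip: powr_add)
  qed
  have a: "y powr (1 + u) \<le> real m * x powr (e - 1)"
  proof -
    have "y powr (1 + u) = x powr e * (x powr - e * y powr (1 + u))"
      using x by (simp flip: powr_add mult.assoc)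
    also have "\<dots> \<le> real m * x powr (e - 1)" using m a' by (intro mult_mono) auto
    finally show ?thesis .
  qed
  have b: "real m * (y * D powr u) \<le> real m * x powr (e - 1) + x powr g * D"
  \<comment> \<open>The threshold is chosen so that \<open>D^u \<le> x^(-e) * y^u\<close> for small
    drops.\<close>
  proof (cases "D \<le> x powr - (u / 2) * y")
    case True
    then have "D powr u \<le> (x powr - (u / 2) * y) powr u"
      using y u by (intro powr_mono2) (auto simp: D_def)
    also have "\<dots> = x powr - e * y powr u"
      by (simp add: powr_mult powr_powr e_def power2_eq_square)
    finally have "y * D powr u \<le> y * (x powr - e * y powr u)" using y by (intro mult_left_mono) auto
    also have "\<dots> = x powr - e * y powr (1 + u)" using y by (simp add: powr_add)
    also note a'
    finally have "real m * (y * D powr u) \<le> real m * x powr (e - 1)" by (intro mult_left_mono) auto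
    moreover have "0 \<le> x powr g * D" using y by (simp add: D_def)
    ultimately show ?thesis by simp
  next
    case False
    have "0 < x powr - (u / 2) * y" using x y by simp
    with False have D: "0 < D" by linarith
    \<comment> \<open>For large drops \<open>D^(u - 1)\<close> is bounded, which makes the cost
      linear in \<open>D\<close>. The exponent \<open>g\<close> collects 5/8 from \<open>m\<close>,
      1/8 from \<open>u * t / 2\<close> and \<open>- t * u\<close> from \<open>y^u\<close>.\<close>
    have "D powr u = D * D powr (u - 1)" using D by (simp add: powr_diff)
    also have "\<dots> \<le> D * (x powr - (u / 2) * y) powr (u - 1)"
      using D False u y x by (intro mult_left_mono powr_mono2') auto
    also have "(x powr - (u / 2) * y) powr (u - 1) = x powr (u * t / 2) * y powr (u - 1)"
    proof -
      have "- (u / 2) * (u - 1) = u * t / 2" by (simp add: u(3) field_simps)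
      then show ?thesis by (simp only: powr_mult powr_powr)
    qed
    finally have "y * D powr u \<le> y * (D * (x powr (u * t / 2) * y powr (u - 1)))"
      using y by (intro mult_left_mono) auto
    also have "\<dots> = D * (x powr (u * t / 2) * y powr u)" using y by (simp add: powr_diff)
    also have "\<dots> \<le> D * (x powr (1 / 8) * (x powr - t) powr u)"
      using D x y ut u by (intro mult_left_mono mult_mono powr_mono powr_mono2) auto
    finally have "real m * (y * D powr u) \<le> x powr (5 / 8) * (D * (x powr (1 / 8) * (x powr - t) powr u))"
      using y by (intro mult_mono[OF m(2)]) auto
    also have "\<dots> = D * (x powr (5 / 8) * (x powr (1 / 8) * x powr (- (t * u))))"
      by (simp add: powr_powr)
    also have "\<dots> = x powr g * D" by (simp add: g_def flip: powr_add)
    finally show ?thesis by (smt (verit) mult_nonneg_nonneg of_nat_0_le_iff powr_ge_zero)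
  qed
  define r where "r = real m / x"
  have r: "0 \<le> r" "r \<le> 1" "x + real m = x * (1 + r)"
  proof -
    note m(2)
    also have "x powr (5 / 8) \<le> x powr 1" using x by (intro powr_mono) auto
    finally have "real m \<le> x" using x by simp
    then show "r \<le> 1" using x by (simp add: r_def)
  qed (use x in \<open>auto simp: r_def field_simps\<close>)
  have xr: "x powr c * r = real m * x powr (c - 1)" for c using x by (simp add: r_def powr_diff)
  have xm: "(x + real m) powr c = x powr c * (1 + r) powr c" for c unfolding r(3) by (rule powr_mult)
  have c: "(x + real m) powr g * y' \<le> x powr g * y' + real m * x powr (e - 1)"
  proof -
    have g: "0 \<le> g" "g \<le> 1" using ut by (auto simp: g_def mult.commute)
    have "(1 + r) powr g \<le> (1 + r) powr 1" using r g by (intro powr_mono) auto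
    then have "x powr g * (1 + r) powr g \<le> x powr g * (1 + r)" using r by (intro mult_left_mono) auto
    then have "(x + real m) powr g \<le> x powr g + real m * x powr (g - 1)"
      by (simp only: xm distrib_left mult_1_right xr)
    then have "(x + real m) powr g * y' \<le> (x powr g + real m * x powr (g - 1)) * y'"
      using y by (intro mult_right_mono) auto
    also have "\<dots> = x powr g * y' + real m * (x powr (g - 1) * y')" by (simp add: algebra_simps)
    also have "x powr (g - 1) * y' \<le> x powr (g - 1) * x powr - t" using y by (intro mult_left_mono) auto
    also have "\<dots> = x powr (2 * e - 5 / 4)"
    proof -
      have "g - 1 + - t = 2 * e - 5 / 4" using tu by (simp add: g_def algebra_simps)
      then show ?thesis by (simp only: powr_add[symmetric])
    qed
    also have "\<dots> \<le> x powr (e - 1)" using x e by (intro powr_mono) auto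
    finally show ?thesis by (simp add: mult_left_mono)
  qed
  have d: "x powr e + e / 2 * (real m * x powr (e - 1)) \<le> (x + real m) powr e"
  proof -
    have "x powr e * (1 + e * r / 2) \<le> x powr e * (1 + r) powr e"
      using one_plus_powr_ge[of r e] r e by (intro mult_left_mono) auto
    moreover have "x powr e * (1 + e * r / 2) = x powr e + e / 2 * (x powr e * r)"
      by (simp add: algebra_simps)
    ultimately show ?thesis by (simp only: xm xr)
  qed
  have "12 / u\<^sup>2 * (x powr e + e / 2 * (real m * x powr (e - 1))) \<le> 12 / u\<^sup>2 * (x + real m) powr e"
    using d by (intro mult_left_mono) auto
  \<comment> \<open>Here \<open>12 / u^2 * (e / 2) = 3\<close>, whence the constant 12 in
    \<open>B\<close>.\<close>
  moreover have "12 / u\<^sup>2 * (x powr e + e / 2 * (real m * x powr (e - 1))) =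
      12 / u\<^sup>2 * x powr e + 3 * (real m * x powr (e - 1))"
    using u by (simp add: e_def field_simps)
  ultimately have "12 / u\<^sup>2 * x powr e + 3 * (real m * x powr (e - 1)) \<le> 12 / u\<^sup>2 * (x + real m) powr e"
    by simp
  moreover have "x powr g * D = x powr g * y - x powr g * y'" by (simp add: D_def algebra_simps)
  ultimately have "12 / u\<^sup>2 * x powr e - x powr g * y + y powr (1 + u) + real m * (y * D powr u) \<le>
      12 / u\<^sup>2 * (x + real m) powr e - (x + real m) powr g * y'"
    using a b c by linarith
  then show ?thesis by (simp add: B_def x_def e_def g_def y_def y'_def D_def)
qed

text \<open>The left-hand side is the girth of the square to be filled. Both it and the subtracted
  term of \<open>B n\<close> are at most \<open>x^e\<close>, whose coefficient in \<open>B n\<close>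
  is at least 2.\<close>

lemma B_start:
  assumes "large n" shows "sqrt (A n) powr (1 + u) \<le> B n"
proof -
  define x e L where "x = real n" and "e = u\<^sup>2 / 2" and "L = ln x"
  have x: "1 < x" "256 \<le> L" using largeD[OF assms(1)] by (auto simp: x_def L_def)
  have e: "0 < e" "e \<le> 1 / 8" using u_sq by (auto simp: e_def)
  have "1 \<le> sqrt L" using x by simp
  then have "L * 1 \<le> 9 * L * sqrt L" using x by (intro mult_mono) auto
  also have "\<dots> \<le> x powr (1 / 8)" using polylog_le[OF assms] by (simp add: x_def L_def)
  finally have L: "L \<le> x powr (1 / 8)" by simp
  have "sqrt (A n) powr (1 + u) = A n powr ((1 + u) / 2)"
    using A_pos[of n] by (simp add: powr_half_sqrt[symmetric] powr_powr)
  also have "\<dots> \<le> (x powr (1 - 2 * t) * L) powr ((1 + u) / 2)"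
    using A_le[OF assms] A_pos[of n] u by (intro powr_mono2) (auto simp: x_def L_def)
  also have "\<dots> = x powr ((1 - 2 * t) * ((1 + u) / 2)) * L powr ((1 + u) / 2)"
    using x by (simp add: powr_mult powr_powr)
  also have "\<dots> \<le> x powr ((1 - 2 * t) * ((1 + u) / 2)) * L powr 1"
    using x u by (intro mult_left_mono powr_mono) auto
  also have "\<dots> \<le> x powr ((1 - 2 * t) * ((1 + u) / 2)) * x powr (1 / 8)"
    using L x by (intro mult_left_mono) auto
  also have "\<dots> = x powr ((1 - 2 * t) * ((1 + u) / 2) + 1 / 8)" by (simp flip: powr_add)
  also have "\<dots> \<le> x powr e"
  proof (intro powr_mono)
    \<comment> \<open>The difference of the two exponents is half of this product.\<close>
    have "0 \<le> (1 / 2 - u) * (3 / 2 + u)" using u by (intro mult_nonneg_nonneg) auto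
    then show "(1 - 2 * t) * ((1 + u) / 2) + 1 / 8 \<le> e"
      by (simp add: u(3) e_def power2_eq_square field_simps)
  qed (use x in simp)
  finally have 1: "sqrt (A n) powr (1 + u) \<le> x powr e" .
  have "x powr (3 / 4 - t * u) * s n \<le> x powr (3 / 4 - t * u) * x powr - t"
    using s_le[of n] x by (intro mult_left_mono) (auto simp: x_def)
  also have "\<dots> = x powr (2 * e - 1 / 4)"
    by (simp add: u(3) e_def power2_eq_square algebra_simps flip: powr_add)
  also have "\<dots> \<le> x powr e" using x e by (intro powr_mono) auto
  finally have 2: "x powr (3 / 4 - t * u) * s n \<le> x powr e" .
  have "2 \<le> 12 / u\<^sup>2" using u_sq by (simp add: field_simps)
  then have "2 * x powr e \<le> 12 / u\<^sup>2 * x powr e" by (intro mult_right_mono) auto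
  with 1 2 show ?thesis unfolding B_def x_def e_def by linarith
qed

end

section \<open>The perfect packing of a square\<close>

lemma squares_pack_perfectly_reindex:
  assumes "squares_pack_perfectly J s \<Omega>" "bij_betw f I J"
  shows "squares_pack_perfectly I (\<lambda>i. s (f i)) \<Omega>"
proof -
  have J: "J = f ` I" and inj: "inj_on f I" using assms(2) by (auto simp: bij_betw_def)
  obtain Q where "\<forall>j\<in>J. is_square (s j) (Q j)" "packed_perfectly J Q \<Omega>"
    using assms(1) by (auto simp: squares_pack_perfectly_def)
  then have "(\<forall>i\<in>I. is_square (s (f i)) (Q (f i))) \<and> packed_perfectly I (\<lambda>i. Q (f i)) \<Omega>"
    using inj by (auto simp: J packed_perfectly_def packed_def pairwise_def inj_on_eq_iff)
  then show ?thesis unfolding squares_pack_perfectly_def by (intro exI[of _ "\<lambda>i. Q (f i)"])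
qed

context prime_sides
begin

lemma perfect_packing:
  assumes "large n"
  shows "squares_pack_perfectly {n..} s (brick_set (0, 0, sqrt (A n), sqrt (A n)))"
proof -
  \<comment> \<open>The indices are shifted by \<open>n\<close>, and \<open>\<delta> = u\<close>, so
    that \<open>1 - \<delta> = t\<close>.\<close>
  interpret greedy "\<lambda>i. s (n + i)" "\<lambda>i. B (n + i)" "\<lambda>i. A (n + i)" u "(0, 0, sqrt (A n), sqrt (A n))"
  proof
    show "antimono (\<lambda>i. s (n + i))" by (auto simp: antimono_def intro: s_anti)
    show "summable (\<lambda>i. (s (n + i))\<^sup>2)" by (rule summable_s_sq')
    show "0 \<le> u" "u < 1" using u by auto
    show "subbrick (0, 0, sqrt (A n), sqrt (A n)) (0, 0, sqrt (A n), sqrt (A n))"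
      using A_pos[of n] by simp
    show "area (0, 0, sqrt (A n), sqrt (A n)) = A (n + 0)" using A_pos[of n] by simp
    have "girth u (0, 0, sqrt (A n), sqrt (A n)) = sqrt (A n) powr (1 + u)"
      using A_pos[of n] by (intro girth_square) simp
    then show "girth u (0, 0, sqrt (A n), sqrt (A n)) \<le> B (n + 0)"
      using B_start[OF assms] by (simp del: girth.simps)
  next
    fix k w
    assume w: "A (n + k) \<le> w powr (1 - u) * B (n + k)" "w\<^sup>2 \<le> A (n + k)" "0 \<le> w"
    have l: "large (n + k)" using assms by (rule large_mono) simp
    obtain m where m: "m > 0" "(\<Sum>i<m. s (n + k + i)) \<le> w" "w - (\<Sum>i<m. s (n + k + i)) \<le> s (n + k)"
      "real (n + k) powr (u\<^sup>2 / 2) \<le> real m" "real m \<le> real (n + k) powr (5 / 8)"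
      using row_length[OF l w(3,2) width_ge[OF l w(3)]] w(1) u(3) by auto
    with B_step[OF l m(4,5)]
    show "\<exists>m>0. (\<Sum>i<m. s (n + (k + i))) \<le> w \<and> w - (\<Sum>i<m. s (n + (k + i))) \<le> s (n + k) \<and>
        B (n + k) + s (n + k) powr (1 + u) +
          real m * (s (n + k) * (s (n + k) - s (n + (k + m))) powr u) \<le> B (n + (k + m))"
      by (auto simp: add.assoc)
  qed (use s_pos in \<open>auto simp: A_def add.assoc\<close>)
  have "bij_betw (\<lambda>i. i - n) {n..} UNIV"
    by (intro bij_betwI[where g = "\<lambda>i. n + i"]) auto
  from squares_pack_perfectly_reindex[OF squares_pack_perfectly this]
  have "squares_pack_perfectly {n..} (\<lambda>i. s (n + (i - n))) (brick_set (0, 0, sqrt (A n), sqrt (A n)))" .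
  \<comment> \<open>Needed because \<open>n + (i - n) = i\<close> holds only for
    \<open>i \<ge> n\<close>, subtraction being truncated.\<close>
  moreover have "squares_pack_perfectly {n..} f \<Omega> \<longleftrightarrow> squares_pack_perfectly {n..} g \<Omega>"
    if "\<And>i. n \<le> i \<Longrightarrow> f i = g i" for f g \<Omega>
    using that by (auto simp: squares_pack_perfectly_def)
  ultimately show ?thesis by (metis (mono_tags, lifting) le_add_diff_inverse)
qed

text \<open>The summands are nonnegative, so the series and the unordered sum agree.\<close>

lemma A_eq_infsum: "A n = (\<Sum>\<^sub>\<infinity>k\<in>{n..}. real (nth_prime k) powr (- 2 * t))"
proof -
  have s2: "(s k)\<^sup>2 = real (nth_prime k) powr (- 2 * t)" for k
    by (simp add: s_def power2_eq_square flip: powr_add)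
  have "((\<lambda>i. (s (n + i))\<^sup>2) has_sum A n) UNIV"
    unfolding A_def by (intro sums_nonneg_imp_has_sum summable_sums summable_s_sq') auto
  then have "((\<lambda>k. (s k)\<^sup>2) has_sum A n) ((+) n ` UNIV)"
    by (subst has_sum_reindex) (auto simp: o_def)
  moreover have "(+) n ` UNIV = {n..}"
    by (auto simp: image_iff) (metis le_add_diff_inverse)
  ultimately show ?thesis unfolding s2 by (simp add: infsumI)
qed

end

theorem corollary4p6:
  fixes \<theta> t :: real and N\<^sub>\<theta> M N\<^sub>0 n\<^sub>0 :: nat
  assumes "0 < \<theta>" and "\<theta> < 1" and "0 < N\<^sub>\<theta>"
    and "\<forall>n\<ge>N\<^sub>\<theta>. real (nth_prime (n + 1)) - real (nth_prime n) \<le> real (nth_prime n) powr \<theta>"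
    and "1 / 2 < t" and "t < 1"
    and "0 < M"
    and "real M \<ge> Max {
        4 powr (1 / (1 - t)) *
          ((20 * 2 powr (6 * t - t\<^sup>2) * (2 * t - 1)) /
           (3 * (1 - t)\<^sup>2 * (1 - 2 powr (1 - 2 * t)))) powr (2 / (t * (1 - t))),
        (50 * (6 / 5) powr (t * (2 - t))) powr (2 / (1 - t))}"
    and "0 < N\<^sub>0"
    and "real N\<^sub>0 \<ge> Max {
        real N\<^sub>\<theta>,
        85536 * real M ^ 5,
        3 * 10 ^ 18,
        2 * exp (16 / (1 - t) ^ 4),
        1 / (1 - 2 powr (- (1 / (2 * t - 1)))),
        real M powr (1 / (1 - t)\<^sup>2),
        (40 / 7 * (1 - t)\<^sup>2) powr (2 / t) *
          (2 powr (1 + 2 * t) / (2 * t - 1)) powr ((2 - t) / t) *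
          real M powr ((1 + t) / t),
        exp (1 / ((2 * t - 1) * (1 - t)))}"
    and "n\<^sub>0 \<ge> N\<^sub>0"
  shows "\<exists>S \<Omega>. is_square S \<Omega> \<and>
           measure lebesgue \<Omega> = (\<Sum>\<^sub>\<infinity>n\<in>{n\<^sub>0..}. real (nth_prime n) powr (- 2 * t)) \<and>
           squares_pack_perfectly {n\<^sub>0..} (\<lambda>n. real (nth_prime n) powr (- t)) \<Omega>"
proof -
  interpret prime_sides t "1 - t" using assms(5,6) by unfold_locales auto
  \<comment> \<open>In exponential form, these bounds contain the two inequalities of
    \<open>large\<close>.\<close>
  have N: "2 * exp (16 / (1 - t) ^ 4) \<le> real n\<^sub>0" "exp (1 / ((2 * t - 1) * (1 - t))) \<le> real n\<^sub>0"
    using assms(10,11) by (auto simp del: Max_insert simp: Max_le_iff)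
  have "exp (16 / (1 - t) ^ 4) \<le> real n\<^sub>0" using N(1) by (smt (verit) exp_gt_zero)
  then have "16 / (1 - t) ^ 4 \<le> ln (real n\<^sub>0)" using exp_gt_zero
    by (metis ln_exp ln_le_cancel_iff order_less_le_trans)
  moreover have "1 / ((2 * t - 1) * (1 - t)) \<le> ln (real n\<^sub>0)" using N(2) exp_gt_zero
    by (metis ln_exp ln_le_cancel_iff order_less_le_trans)
  then have "1 / (2 * t - 1) / (1 - t) \<le> ln (real n\<^sub>0)" by simp
  then have "1 / (2 * t - 1) \<le> (1 - t) * ln (real n\<^sub>0)"
    using t by (subst (asm) pos_divide_le_eq) (auto simp: mult.commute)
  ultimately have l: "large n\<^sub>0" by (simp add: large_def)
  define S where "S = sqrt (A n\<^sub>0)"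
  have "0 < S" using A_pos by (simp add: S_def)
  then have "is_square S (brick_set (0, 0, S, S))" by (rule is_square_brick_set)
  moreover have "measure lebesgue (brick_set (0, 0, S, S)) = A n\<^sub>0"
    using \<open>0 < S\<close> by (subst measure_brick_set) (auto simp: S_def)
  ultimately show ?thesis using perfect_packing[OF l] unfolding A_eq_infsum[symmetric]
    by (intro exI[of _ S] exI[of _ "brick_set (0, 0, S, S)"]) (auto simp: S_def s_def[abs_def])
qed

end
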